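(* Let $N\ge 1$ be an integer, let $\lambda>0$, let $\mathsf{h}_N^\lambda=\mathbf{P}_N h_0^\lambda\in\mathbb{C}^N$, where $h_0^\lambda(t)=e^{-\pi\lambda t^2}$, and let $\{(j_k,l_k)\}_{k=1,\dots,K}$ be a collection of $K$ distinct pairs of integers $j_k,l_k\in\{0,\dots,N-1\}$. The following are equivalent: 1) The set $\{(j_k,l_k)\}_{k=1,\dots,K}$ gives rise to a finite Gabor frame with window $\mathsf{h}_N^\lambda$, i.e., there are constants $A,B>0$ such that, for every $\mathsf{f}\in\mathbb{C}^N$, $$A\|\mathsf{f}\|_{\mathbb{C}^N}^2\le\sum_{k=1}^K\left|\mathbf{V}_{\mathsf{h}_N^\lambda}\mathsf{f}[j_k,l_k]\right|^2\le B\|\mathsf{f}\|_{\mathbb{C}^N}^2 .$$ 2) One of the three following conditions is satisfied: (i) $N^2\ge K\ge N+1$; (ii) $K=N$ is odd; (iii) $K=N$ is even and $\sum_{k=1}^N(j_k,l_k)\notin N\mathbb{N}\times N\mathbb{N}$.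
   Context: The operator $\mathbf{P}_N$ samples the periodization of a function: $\mathbf{P}_N f=\big(\sum_{j\in\mathbb{Z}}f(n/N-j)\big)_{n=0}^{N-1}\in\mathbb{C}^N$. The discrete Gabor transform on $\mathbb{C}^N$ is $\mathbf{V}_{\mathsf{g}}\mathsf{f}[k,l]=\sum_{m=0}^{N-1}\mathsf{f}[m]\,\overline{\mathsf{g}[m-k]}\,e^{-2\pi i lm/N}$ for $\mathsf{f},\mathsf{g}\in\mathbb{C}^N$, with indices taken modulo $N$. $\|\cdot\|_{\mathbb{C}^N}$ is the Euclidean norm. The sum $\sum_k (j_k,l_k)$ is the componentwise sum in $\mathbb{Z}^2$ (not reduced modulo $N$), and $N\mathbb{N}$ denotes the set of multiples of $N$ by natural numbers. *)

theory Defs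
  imports
    "HOL-Analysis.L2_Norm"
    "HOL-Analysis.Infinite_Sum"
    "HOL-Library.Product_Plus"
    "Jordan_Normal_Form.Matrix"
begin

text \<open>
  Vectors of \<open>\<complex>\<^sup>N\<close> are elements of \<open>carrier_vec N\<close>, so their
  indices are \<open>0, \<dots>, N - 1\<close>.
\<close>

definition vec_at :: "nat \<Rightarrow> complex Matrix.vec \<Rightarrow> int \<Rightarrow> complex" where
  "vec_at N f i = vec_index f (nat (i mod int N))"

definition euclid_norm :: "complex Matrix.vec \<Rightarrow> real" where
  "euclid_norm f = L2_set (\<lambda>m. cmod (vec_index f m)) {..<dim_vec f}"

definition sample_periodization :: "nat \<Rightarrow> (real \<Rightarrow> complex) \<Rightarrow> complex Matrix.vec" where
  "sample_periodization N f =
     Matrix.vec N (\<lambda>n. \<Sum>\<^sub>\<infinity>j::int. f (real n / real N - of_int j))"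

definition gaussian :: "real \<Rightarrow> real \<Rightarrow> complex" where
  "gaussian lam t = complex_of_real (exp (- pi * lam * t\<^sup>2))"

definition discrete_gabor ::
  "nat \<Rightarrow> complex Matrix.vec \<Rightarrow> complex Matrix.vec \<Rightarrow> int \<Rightarrow> int \<Rightarrow> complex" where
  "discrete_gabor N g f k l =
     (\<Sum>m<N. vec_at N f (int m) * cnj (vec_at N g (int m - k)) *
        exp (- 2 * of_real pi * \<i> * of_int l * of_nat m / of_nat N))"

definition gabor_frame ::
  "nat \<Rightarrow> complex Matrix.vec \<Rightarrow> nat \<Rightarrow> (nat \<Rightarrow> int) \<Rightarrow> (nat \<Rightarrow> int) \<Rightarrow> bool" where
  "gabor_frame N g K j l \<longleftrightarrow>
     (\<exists>A B::real. A > 0 \<and> B > 0 \<and>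
        (\<forall>f \<in> carrier_vec N.
           A * (euclid_norm f)\<^sup>2 \<le> (\<Sum>k=1..K. (cmod (discrete_gabor N g f (j k) (l k)))\<^sup>2) \<and>
           (\<Sum>k=1..K. (cmod (discrete_gabor N g f (j k) (l k)))\<^sup>2) \<le> B * (euclid_norm f)\<^sup>2))"

definition nat_multiples :: "nat \<Rightarrow> int set" where
  "nat_multiples N = {int N * int m | m::nat. True}"

end

theory Submission
  imports
    Defs
    "HOL-Complex_Analysis.Complex_Analysis"
    "Jordan_Normal_Form.Determinant"
begin

text \<open>
  Put \<open>p = exp (- 2 \<pi> lam / N)\<close>. A vector \<open>f\<close> determines the Laurent series
  \<open>F(u) = \<Sum>m<N. f\<^sub>m \<cdot> \<theta>\<^sub>m(u)\<close>, where \<open>\<theta>\<^sub>m(u)\<close> sums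
  \<open>exp (- \<pi> lam (n/N)\<^sup>2) u\<^sup>n\<close> over all integers \<open>n\<close> congruent to \<open>m\<close> modulo \<open>N\<close>.
  Completing the square shows that, up to a positive factor, the Gabor coefficient of \<open>f\<close> at
  \<open>(k, l)\<close> is the value of \<open>F\<close> at the node
  \<open>exp (2 \<pi> lam k / N\<^sup>2 - 2 \<pi> \<i> l / N)\<close> (lemma \<open>gabor_theta_at_node\<close>). The nodes with
  \<open>0 \<le> k, l < N\<close> are pairwise incongruent modulo multiplication by powers of \<open>p\<close>. Since the
  space is finite-dimensional, the frame inequalities say exactly that no nonzero \<open>f\<close> has an
  \<open>F\<close> vanishing at all chosen nodes (lemma \<open>gabor_frame_iff_injective\<close>).

  The function \<open>F\<close> is holomorphic on the punctured plane and
  \<open>F(p u) u\<^sup>N = exp (\<pi> lam) F(u)\<close>, so it is a theta function of degree \<open>N\<close> on the torus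
  of the punctured plane modulo powers of \<open>p\<close>. Such functions are governed by their zeros. If
  \<open>F\<close> vanishes at \<open>N\<close> incongruent points \<open>a\<^sub>i\<close>, dividing it by the theta functions
  \<open>\<theta>(u / a\<^sub>i)\<close>, which have simple zeros exactly at the points congruent to \<open>a\<^sub>i\<close>, leaves
  a function that is multiplied by a constant under \<open>u \<mapsto> p u\<close>. By Liouville's theorem it is a
  monomial, so \<open>F(u) = C u\<^sup>n \<Prod>\<^sub>i \<theta>(u / a\<^sub>i)\<close>. Comparing multipliers, \<open>C \<noteq> 0\<close> forces
  the relation of Abel's theorem \<open>exp (\<pi> lam) = (-1)\<^sup>N (\<Prod>\<^sub>i a\<^sub>i) p\<^sup>n\<close>
  (lemma \<open>theta_factorization\<close>). If the \<open>a\<^sub>i\<close> are nodes and \<open>S\<close>, \<open>L\<close> are the sums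
  of their coordinates, the moduli give \<open>N\<^sup>2 = 2 S - 2 n N\<close> and the phases give that \<open>N\<close>
  divides \<open>L\<close>; an integer \<open>n\<close> as required exists if and only if \<open>N\<close> is even and divides
  both \<open>S\<close> and \<open>L\<close> (lemma \<open>abel_condition\<close>).

  All cases follow. Fewer than \<open>N\<close> nodes give fewer than \<open>N\<close> linear equations, so a nonzero
  \<open>f\<close> exists. With \<open>N\<close> nodes that violate Abel's relation, \<open>C = 0\<close>. With more than
  \<open>N\<close> nodes the product does not vanish at one more node, so again \<open>C = 0\<close>. Finally, suppose
  that \<open>N\<close> nodes satisfy Abel's relation. Then the product \<open>\<Phi>\<close> over all \<open>N\<close> nodes
  transforms like \<open>F\<close>. Take a nonzero \<open>f\<close> for which \<open>F\<close> vanishes at the first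
  \<open>N - 1\<close> nodes, and choose \<open>\<kappa>\<close> such that \<open>F - \<kappa> \<Phi>\<close> vanishes at one further point
  incongruent to all nodes. These \<open>N\<close> zeros violate Abel's relation, so \<open>F = \<kappa> \<Phi>\<close>, and
  \<open>F\<close> vanishes at the last node for free (lemma \<open>not_injective_if_abel\<close>).
\<close>

section \<open>The theta function of degree one\<close>

text \<open>
  The \<open>q\<close>-Pochhammer symbol with infinitely many factors, for the base \<open>p\<close>.
\<close>

definition qprod :: "real \<Rightarrow> complex \<Rightarrow> complex" where
  "qprod p u = (\<Prod>n. 1 - of_real p ^ n * u)"

text \<open>
  Jacobi's theta function in its product form. The product form is chosen because the zeros are
  visible in it.
\<close>

definition theta :: "real \<Rightarrow> complex \<Rightarrow> complex" where
  "theta p u = qprod p u * qprod p (of_real p / u)"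

context
  fixes p :: real
  assumes p0: "0 < p" and p1: "p < 1"
begin

lemma qprod_LIMSEQ: "(\<lambda>n. \<Prod>k<n. 1 - of_real p ^ k * u) \<longlonglongrightarrow> qprod p u"
proof -
  have "summable (\<lambda>k. norm (1 - of_real p ^ k * u - 1))"
    using p0 p1 by (auto simp: norm_mult norm_power intro!: summable_mult2 summable_geometric)
  then have "convergent_prod (\<lambda>k. 1 - of_real p ^ k * u)"
    by (intro abs_convergent_prod_imp_convergent_prod summable_imp_abs_convergent_prod) auto
  from convergent_prod_LIMSEQ[OF this] show ?thesis
    by (simp add: qprod_def LIMSEQ_lessThan_iff_atMost)
qed

lemma qprod_0 [simp]: "qprod p 0 = 1"
  by (simp add: qprod_def)

lemma qprod_rec: "qprod p u = (1 - u) * qprod p (of_real p * u)"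
proof -
  have "(\<Prod>k<Suc n. 1 - of_real p ^ k * u) = (1 - u) * (\<Prod>k<n. 1 - of_real p ^ k * (of_real p * u))" for n
    by (subst prod.lessThan_Suc_shift) (simp add: mult_ac)
  then have "(\<lambda>n. \<Prod>k<Suc n. 1 - of_real p ^ k * u) \<longlonglongrightarrow> (1 - u) * qprod p (of_real p * u)"
    by (simp only:) (intro tendsto_intros qprod_LIMSEQ)
  moreover have "(\<lambda>n. \<Prod>k<Suc n. 1 - of_real p ^ k * u) \<longlonglongrightarrow> qprod p u"
    by (rule LIMSEQ_Suc[OF qprod_LIMSEQ])
  ultimately show ?thesis
    using LIMSEQ_unique by blast
qed

lemma qprod_holomorphic: "qprod p holomorphic_on UNIV"
proof (rule holomorphic_uniform_sequence[where f = "\<lambda>n u. \<Prod>k<n. 1 - of_real p ^ k * u"])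
  show "(\<lambda>u. \<Prod>k<n. 1 - of_real p ^ k * u) holomorphic_on UNIV" for n
    by (intro holomorphic_intros)
  fix x :: complex
  have "uniformly_convergent_on (cball x 1) (\<lambda>N u. \<Prod>n<N. 1 - of_real p ^ n * u)"
  proof (rule uniformly_convergent_on_prod')
    show "uniformly_convergent_on (cball x 1) (\<lambda>N u. \<Sum>n<N. norm (1 - complex_of_real p ^ n * u - 1))"
    proof (rule Weierstrass_m_test')
      show "norm (norm (1 - complex_of_real p ^ n * u - 1)) \<le> p ^ n * (norm x + 1)"
        if "u \<in> cball x 1" for n u
      proof -
        have "norm u \<le> norm x + norm (u - x)"
          by (metis add.commute diff_add_cancel norm_triangle_ineq)
        with that have "norm u \<le> norm x + 1"
          by (simp add: dist_norm norm_minus_commute)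
        then show ?thesis
          using p0 by (auto simp: norm_mult norm_power intro!: mult_left_mono)
      qed
      show "summable (\<lambda>n. p ^ n * (norm x + 1))"
        using p0 p1 by (intro summable_mult2 summable_geometric) auto
    qed
  qed (auto intro!: continuous_intros)
  then obtain L where L: "uniform_limit (cball x 1) (\<lambda>N u. \<Prod>n<N. 1 - of_real p ^ n * u) L sequentially"
    by (auto simp: uniformly_convergent_on_def)
  have "L u = qprod p u" if "u \<in> cball x 1" for u
    using tendsto_uniform_limitI[OF L that] qprod_LIMSEQ LIMSEQ_unique by blast
  then have "uniform_limit (cball x 1) (\<lambda>N u. \<Prod>n<N. 1 - of_real p ^ n * u) (qprod p) sequentially"
    using L by (subst uniform_limit_cong'[of _ _ _ "qprod p" L]) auto
  then show "\<exists>d>0. cball x d \<subseteq> UNIV \<and>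
      uniform_limit (cball x d) (\<lambda>N u. \<Prod>n<N. 1 - of_real p ^ n * u) (qprod p) sequentially"
    by (intro exI[of _ 1]) auto
qed auto

text \<open>
  The recursion moves a zero \<open>u\<close> to \<open>p u\<close> as long as \<open>u \<noteq> 1\<close>. A zero whose orbit
  avoids \<open>1\<close> would therefore produce zeros \<open>p\<^sup>n u\<close> converging to \<open>0\<close>, where the
  value is \<open>1\<close>.
\<close>

lemma qprod_eq_0_iff: "qprod p u = 0 \<longleftrightarrow> (\<exists>n. of_real p ^ n * u = 1)"
proof
  show "\<exists>n. of_real p ^ n * u = 1 \<Longrightarrow> qprod p u = 0"
  proof (elim exE)
    fix n show "of_real p ^ n * u = 1 \<Longrightarrow> qprod p u = 0"
    proof (induction n arbitrary: u)
      case 0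
      then show ?case by (subst qprod_rec) simp
    next
      case (Suc n)
      then have "qprod p (of_real p * u) = 0"
        by (simp add: mult_ac)
      then show ?case by (subst qprod_rec) simp
    qed
  qed
  show "\<exists>n. of_real p ^ n * u = 1" if "qprod p u = 0"
  proof (rule ccontr)
    assume neg: "\<nexists>n. of_real p ^ n * u = 1"
    have zero: "qprod p (of_real p ^ n * u) = 0" for n
    proof (induction n)
      case (Suc n)
      then show ?case
        using qprod_rec[of "of_real p ^ n * u"] neg by (auto simp: mult_ac)
    qed (use that in simp)
    have "(\<lambda>n. of_real p ^ n * u) \<longlonglongrightarrow> 0 * u"
      using p0 p1 by (intro tendsto_intros LIMSEQ_power_zero) auto
    moreover have "isCont (qprod p) 0"
      using qprod_holomorphic holomorphic_on_imp_continuous_on continuous_on_eq_continuous_at by blast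
    ultimately have "(\<lambda>n. qprod p (of_real p ^ n * u)) \<longlonglongrightarrow> qprod p 0"
      using isCont_tendsto_compose by fastforce
    then show False
      by (simp add: zero LIMSEQ_const_iff)
  qed
qed

lemma theta_holomorphic: "theta p holomorphic_on - {0}"
proof -
  have "(\<lambda>u. qprod p (of_real p / u)) holomorphic_on - {0}"
    by (rule holomorphic_on_compose_gen[OF _ qprod_holomorphic, unfolded o_def])
      (auto intro!: holomorphic_intros)
  then show ?thesis
    unfolding theta_def
    by (intro holomorphic_intros holomorphic_on_subset[OF qprod_holomorphic]) auto
qed

text \<open>
  Passing from \<open>u\<close> to \<open>p u\<close> removes the factor \<open>1 - u\<close> from the first product and
  adds the factor \<open>1 - 1 / u\<close> to the second; their quotient is \<open>- 1 / u\<close>.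
\<close>

lemma theta_shift:
  assumes "u \<noteq> 0"
  shows "theta p (of_real p * u) = - theta p u / u"
proof (cases "u = 1")
  \<comment> \<open>Here the removed factor is zero and cannot be cancelled, but both sides vanish.\<close>
  case True
  have "qprod p 1 = 0"
    by (subst qprod_rec) simp
  then show ?thesis using True p0 by (simp add: theta_def)
next
  case False
  have "theta p (of_real p * u) = qprod p (of_real p * u) * qprod p (1 / u)"
    using assms p0 by (simp add: theta_def)
  also have "qprod p (1 / u) = (1 - 1 / u) * qprod p (of_real p / u)"
    by (subst qprod_rec) simp
  also have "qprod p (of_real p * u) * \<dots> = - ((1 - u) * qprod p (of_real p * u)) * qprod p (of_real p / u) / u"
    using assms by (simp add: field_simps)
  also have "(1 - u) * qprod p (of_real p * u) = qprod p u"
    by (rule qprod_rec[symmetric])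
  finally show ?thesis
    by (simp add: theta_def)
qed

lemma theta_eq_0_iff:
  assumes "u \<noteq> 0"
  shows "theta p u = 0 \<longleftrightarrow> (\<exists>n::int. u = of_real p powi n)"
proof
  assume "theta p u = 0"
  then consider n where "of_real p ^ n * u = 1" | n where "of_real p ^ n * (of_real p / u) = 1"
    by (auto simp: theta_def qprod_eq_0_iff)
  then show "\<exists>n::int. u = of_real p powi n"
  proof cases
    case 1
    then have "u = of_real p powi (- int n)"
      using p0 by (simp add: power_int_minus field_simps)
    then show ?thesis ..
  next
    case 2
    then have "u = of_real p powi int (Suc n)"
      unfolding power_int_of_nat using assms by (simp add: field_simps)
    then show ?thesis ..
  qed
next
  assume "\<exists>n::int. u = of_real p powi n"
  then obtain n :: int where u: "u = of_real p powi n" ..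
  show "theta p u = 0"
  proof (cases "n > 0")
    case True
    then obtain k where k: "n = int (Suc k)"
      using zero_less_imp_eq_int gr0_implies_Suc by blast
    have "of_real p ^ k * (of_real p / u) = 1"
      unfolding u k power_int_of_nat using p0 by simp
    then have "qprod p (of_real p / u) = 0"
      unfolding qprod_eq_0_iff ..
    then show ?thesis by (simp add: theta_def)
  next
    case False
    then obtain k where "n = - int k"
      by (metis nonpos_int_cases not_less)
    then have "of_real p ^ k * u = 1"
      using u p0 by (simp add: power_int_minus)
    then have "qprod p u = 0"
      unfolding qprod_eq_0_iff ..
    then show ?thesis by (simp add: theta_def)
  qed
qed

lemma theta_has_derivative: "u \<noteq> 0 \<Longrightarrow> (theta p has_field_derivative deriv (theta p) u) (at u)"
  by (intro holomorphic_derivI[OF theta_holomorphic]) auto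

text \<open>
  The zero at \<open>1\<close> comes from the single factor \<open>1 - u\<close>; the remaining factors do not
  vanish there.
\<close>

lemma deriv_theta_at_1: "deriv (theta p) 1 \<noteq> 0"
proof -
  define r where "r u = qprod p (of_real p * u) * qprod p (of_real p / u)" for u
  have eq: "theta p u = (1 - u) * r u" for u
    unfolding theta_def r_def by (subst qprod_rec) (simp add: mult_ac)
  have "r holomorphic_on - {0}"
  proof -
    have "(\<lambda>u. qprod p (of_real p / u)) holomorphic_on - {0}"
      by (rule holomorphic_on_compose_gen[OF _ qprod_holomorphic, unfolded o_def])
        (auto intro!: holomorphic_intros)
    moreover have "(\<lambda>u. qprod p (of_real p * u)) holomorphic_on - {0}"
      by (rule holomorphic_on_compose_gen[OF _ qprod_holomorphic, unfolded o_def])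
        (auto intro!: holomorphic_intros)
    ultimately show ?thesis
      unfolding r_def by (intro holomorphic_intros)
  qed
  then have "(r has_field_derivative deriv r 1) (at 1)"
    by (rule holomorphic_derivI) auto
  then have "((\<lambda>u. (1 - u) * r u) has_field_derivative - r 1) (at 1)"
    by (auto intro!: derivative_eq_intros)
  then have "deriv (theta p) 1 = - r 1"
    unfolding eq[symmetric] by (rule DERIV_imp_deriv)
  moreover have "r 1 \<noteq> 0"
  proof -
    have "complex_of_real p ^ n * of_real p \<noteq> 1" for n
    proof -
      have "norm (complex_of_real p ^ n * of_real p) = p ^ Suc n"
        using p0 by (simp add: norm_mult norm_power)
      moreover have "p ^ Suc n < 1"
        using p0 p1 by (intro power_Suc_less_one) auto
      ultimately show ?thesis by auto
    qed
    then show ?thesis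
      by (auto simp: r_def qprod_eq_0_iff)
  qed
  ultimately show ?thesis by simp
qed

lemma deriv_theta_shift:
  assumes "u \<noteq> 0" "theta p u = 0"
  shows "deriv (theta p) (of_real p * u) * of_real p = - deriv (theta p) u / u"
proof -
  have "((\<lambda>v. theta p (of_real p * v)) has_field_derivative deriv (theta p) (of_real p * u) * of_real p) (at u)"
    using assms p0 by (intro DERIV_chain2[OF theta_has_derivative DERIV_cmult_Id]) auto
  moreover have "((\<lambda>v. - theta p v / v) has_field_derivative - deriv (theta p) u / u) (at u)"
    using DERIV_divide[OF DERIV_minus[OF theta_has_derivative[OF assms(1)]] DERIV_ident assms(1)] assms
    by simp
  moreover have ev: "\<forall>\<^sub>F v in nhds u. theta p (of_real p * v) = - theta p v / v"
    using t1_space_nhds[OF assms(1)] by eventually_elim (rule theta_shift)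
  ultimately have "((\<lambda>v. - theta p v / v) has_field_derivative deriv (theta p) (of_real p * u) * of_real p) (at u)"
    by (subst (asm) DERIV_cong_ev[OF refl ev refl])
  then show ?thesis
    using DERIV_unique \<open>((\<lambda>v. - theta p v / v) has_field_derivative - deriv (theta p) u / u) (at u)\<close>
    by blast
qed

text \<open>
  All zeros are simple: differentiating the functional equation at a zero transports simplicity
  from \<open>1\<close> to every power of \<open>p\<close>.
\<close>

lemma deriv_theta_nonzero:
  assumes "u \<noteq> 0" "theta p u = 0"
  shows "deriv (theta p) u \<noteq> 0"
proof -
  obtain n :: int where n: "u = of_real p powi n"
    using assms theta_eq_0_iff by blast
  have zero: "theta p (of_real p powi i) = 0" for i :: int
    using p0 by (subst theta_eq_0_iff) auto
  have nz: "of_real p powi i \<noteq> (0::complex)" for i :: int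
    using p0 by simp
  have step: "deriv (theta p) (of_real p powi (i + 1)) = 0 \<longleftrightarrow> deriv (theta p) (of_real p powi i) = 0" for i :: int
    using deriv_theta_shift[OF nz[of i] zero] p0 nz[of i] by (auto simp: power_int_add mult.commute)
  have "deriv (theta p) (of_real p powi n) \<noteq> 0"
  proof (induction n rule: int_induct[of _ 0])
    case base
    then show ?case using deriv_theta_at_1 by simp
  next
    case (step1 i)
    then show ?case using step[of i] by simp
  next
    case (step2 i)
    then show ?case using step[of "i - 1"] by simp
  qed
  then show ?thesis by (simp add: n)
qed

end

section \<open>Factorization of theta functions\<close>

text \<open>
  At a simple zero of \<open>g\<close> the quotient has the limit given by l'Hopital's rule, so its
  singularity is removable.
\<close>

lemma holomorphic_quotient_simple_zeros:
  assumes "open S" and f: "f holomorphic_on S" and g: "g holomorphic_on S"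
    and zeros: "\<And>z. z \<in> S \<Longrightarrow> g z = 0 \<Longrightarrow> f z = 0 \<and> deriv g z \<noteq> 0"
  obtains h where "h holomorphic_on S" and "\<And>z. z \<in> S \<Longrightarrow> f z = h z * g z"
proof
  define h where "h z = (if g z = 0 then deriv f z / deriv g z else f z / g z)" for z
  show "f z = h z * g z" if "z \<in> S" for z
    using zeros[OF that] by (simp add: h_def)
  have "h field_differentiable at z" if z: "z \<in> S" for z
  proof -
    have df: "(f has_field_derivative deriv f z) (at z)"
      and dg: "(g has_field_derivative deriv g z) (at z)"
      using f g \<open>open S\<close> z by (auto intro: holomorphic_derivI)
    have "\<forall>\<^sub>F w in at z. g w \<noteq> 0"
    proof (cases "g z = 0")
      case True
      have "((\<lambda>w. (g w - g z) / (w - z)) \<longlongrightarrow> deriv g z) (at z)"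
        using dg by (simp add: has_field_derivative_iff)
      then have "\<forall>\<^sub>F w in at z. (g w - g z) / (w - z) \<noteq> 0"
        using zeros[OF z True] by (intro tendsto_imp_eventually_ne) auto
      then show ?thesis
        by eventually_elim (auto simp: True)
    next
      case False
      have "(g \<longlongrightarrow> g z) (at z)"
        using DERIV_isCont[OF dg] by (simp add: isCont_def)
      then show ?thesis
        using False by (rule tendsto_imp_eventually_ne)
    qed
    moreover have "\<forall>\<^sub>F w in at z. w \<in> S"
      using \<open>open S\<close> z by (intro eventually_at_in_open') auto
    ultimately have "\<forall>\<^sub>F w in at z. g w \<noteq> 0 \<and> w \<in> S"
      by eventually_elim auto
    then obtain e where e: "e > 0" "\<And>w. w \<in> ball z e - {z} \<Longrightarrow> g w \<noteq> 0 \<and> w \<in> S"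
      by (auto simp: eventually_at dist_commute)
    have sub: "ball z e \<subseteq> S"
      using e(2) z by fastforce
    have "h holomorphic_on ball z e"
    proof (rule no_isolated_singularity'[where K = "{z}"])
      have "(\<lambda>w. f w / g w) holomorphic_on ball z e - {z}"
        using e sub by (intro holomorphic_intros holomorphic_on_subset[OF f] holomorphic_on_subset[OF g]) auto
      then show "h holomorphic_on ball z e - {z}"
        by (rule holomorphic_transform) (use e(2) in \<open>auto simp: h_def\<close>)
      have "((\<lambda>w. f w / g w) \<longlongrightarrow> h z) (at z)"
      proof (cases "g z = 0")
        case True
        then show ?thesis
          using zeros[OF z True] by (intro lhopital_complex_simple[OF df dg]) (auto simp: h_def)
      next
        case False
        then show ?thesis
          using DERIV_isCont[OF df] DERIV_isCont[OF dg]
          by (auto simp: isCont_def h_def intro!: tendsto_intros)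
      qed
      moreover have "\<forall>\<^sub>F w in at z. f w / g w = h w"
        using \<open>\<forall>\<^sub>F w in at z. g w \<noteq> 0 \<and> w \<in> S\<close> by eventually_elim (simp add: h_def)
      ultimately have "(h \<longlongrightarrow> h z) (at z)"
        by (rule Lim_transform_eventually)
      then have "(h \<longlongrightarrow> h z) (at z within ball z e)"
        by (rule Lim_at_imp_Lim_at_within)
      then show "(h \<longlongrightarrow> h w) (at w within ball z e)" if "w \<in> {z}" for w
        using that by simp
    qed simp_all
    then show ?thesis
      using e(1) holomorphic_on_imp_differentiable_at by force
  qed
  then show "h holomorphic_on S"
    using \<open>open S\<close> by (simp add: holomorphic_on_open field_differentiable_def)
qed

text \<open>
  Cancellation of a factor that is not identically zero, across its zeros, by the identity theorem.
\<close>

lemma holomorphic_mult_eq_0: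
  assumes "open S" "connected S" and f: "f holomorphic_on S" and g: "g holomorphic_on S"
    and fg: "\<And>z. z \<in> S \<Longrightarrow> f z * g z = 0" and w: "w \<in> S" "g w \<noteq> 0"
    and z: "z \<in> S"
  shows "f z = 0"
proof (rule analytic_continuation_open[where f = f and g = "\<lambda>_. 0"])
  show "open {z \<in> S. g z \<noteq> 0}"
  proof -
    have "open (S \<inter> g -` (- {0}))"
      using holomorphic_on_imp_continuous_on[OF g] \<open>open S\<close> by (intro continuous_open_preimage) auto
    moreover have "S \<inter> g -` (- {0}) = {z \<in> S. g z \<noteq> 0}" by auto
    ultimately show ?thesis by simp
  qed
qed (use assms in auto)

text \<open>
  The case of degree zero. A factor \<open>\<bar>u\<bar>\<^sup>\<alpha>\<close> with a suitable real \<open>\<alpha>\<close> turns \<open>\<bar>Q\<bar>\<close> into a function that is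
  invariant under \<open>u \<mapsto> p u\<close>, hence bounded by its maximum on one closed annulus. In the
  logarithmic coordinate \<open>w\<close> with \<open>u = exp w\<close> it is the modulus of the entire function
  \<open>Q (exp w) exp (\<alpha> w)\<close>, which Liouville's theorem makes constant. Going once around the origin
  then shows that \<open>\<alpha>\<close> is an integer, unless \<open>Q\<close> vanishes.
\<close>

lemma multiplicative_period_monomial:
  fixes p :: real and Q :: "complex \<Rightarrow> complex"
  assumes p: "0 < p" "p < 1" and Q: "Q holomorphic_on - {0}" and "c \<noteq> 0"
    and per: "\<And>u. u \<noteq> 0 \<Longrightarrow> Q (of_real p * u) = c * Q u"
  obtains C and n :: int where "\<And>u. u \<noteq> 0 \<Longrightarrow> Q u = C * u powi n"
    and "C \<noteq> 0 \<Longrightarrow> c = of_real p powi n"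
proof -
  \<comment> \<open>This exponent solves \<open>p powr \<alpha> * norm c = 1\<close>, which makes \<open>M\<close> invariant.\<close>
  define \<alpha> where "\<alpha> = - ln (norm c) / ln p"
  define M where "M u = norm (Q u) * norm u powr \<alpha>" for u
  have "p powr \<alpha> = inverse (norm c)"
    using p \<open>c \<noteq> 0\<close> by (simp add: powr_def \<alpha>_def exp_minus)
  then have M_per: "M (of_real p * u) = M u" if "u \<noteq> 0" for u
    using p \<open>c \<noteq> 0\<close> by (simp add: M_def per that norm_mult powr_mult)
  have M_powi: "M (of_real p powi n * u) = M u" if "u \<noteq> 0" for u and n :: int
  proof (induction n rule: int_induct[of _ 0])
    case base
    then show ?case by simp
  next
    case (step1 i)
    then show ?case
      using M_per[of "of_real p powi i * u"] that p by (simp add: power_int_add mult_ac)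
  next
    case (step2 i)
    then show ?case
      using M_per[of "of_real p powi (i - 1) * u"] that p by (simp add: power_int_diff mult_ac)
  qed
  have "compact (M ` {u. p \<le> norm u \<and> norm u \<le> 1})"
  proof (rule compact_continuous_image)
    have "continuous_on {u. p \<le> norm u \<and> norm u \<le> 1} Q"
      using p by (intro continuous_on_subset[OF holomorphic_on_imp_continuous_on[OF Q]]) auto
    then show "continuous_on {u. p \<le> norm u \<and> norm u \<le> 1} M"
      unfolding M_def using p by (intro continuous_intros) auto
    have "{u::complex. p \<le> norm u \<and> norm u \<le> 1} = cball 0 1 - ball 0 p" by auto
    then show "compact {u::complex. p \<le> norm u \<and> norm u \<le> 1}"
      by (simp add: compact_diff)
  qed
  then have "bounded (M ` {u. p \<le> norm u \<and> norm u \<le> 1})"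
    by (rule compact_imp_bounded)
  then obtain B where B: "\<And>u. p \<le> norm u \<Longrightarrow> norm u \<le> 1 \<Longrightarrow> norm (M u) \<le> B"
    by (auto simp: bounded_iff)
  have M_le: "M u \<le> B" if "u \<noteq> 0" for u
  proof -
    \<comment> \<open>Some power of \<open>p\<close> moves \<open>u\<close> into the annulus.\<close>
    define n where "n = \<lceil>- ln (norm u) / ln p\<rceil>"
    have "ln p < 0" using p by simp
    have "- ln (norm u) / ln p \<le> of_int n" "of_int n \<le> - ln (norm u) / ln p + 1"
      unfolding n_def by linarith+
    then have "of_int n * ln p + ln (norm u) \<le> 0" "ln p \<le> of_int n * ln p + ln (norm u)"
      using \<open>ln p < 0\<close> by (simp_all add: field_simps)
    moreover have "norm (of_real p powi n * u) = exp (of_int n * ln p + ln (norm u))"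
      using p that exp_power_int[of "ln p" n] by (simp add: norm_mult norm_power_int exp_add)
    ultimately have "p \<le> norm (of_real p powi n * u)" "norm (of_real p powi n * u) \<le> 1"
      using p by (simp_all, metis exp_le_cancel_iff exp_ln)
    from B[OF this] show ?thesis
      by (simp add: M_powi that)
  qed
  define G where "G w = Q (exp w) * exp (of_real \<alpha> * w)" for w
  have "G constant_on UNIV"
  proof (rule Liouville_theorem)
    have "(Q \<circ> exp) holomorphic_on UNIV"
      by (rule holomorphic_on_compose_gen[OF _ Q]) (auto intro!: holomorphic_intros)
    then show "G holomorphic_on UNIV"
      unfolding G_def o_def by (intro holomorphic_intros)
    have "norm (G w) = M (exp w)" for w
      by (simp add: G_def M_def norm_mult powr_def)
    then show "bounded (range G)"
      using M_le by (intro boundedI[where B = B]) auto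
  qed
  then obtain C where C: "\<And>w. G w = C"
    by (auto simp: constant_on_def)
  have Q_exp: "Q (exp w) = C * exp (- of_real \<alpha> * w)" for w
    using C[of w] by (simp add: G_def exp_minus field_simps)
  show thesis
  proof (cases "C = 0")
    case True
    have "Q u = 0" if "u \<noteq> 0" for u
      using Q_exp[of "Ln u"] that True by simp
    then show thesis
      by (intro that[of 0 0]) auto
  next
    case False
    have "exp (- of_real \<alpha> * (2 * of_real pi * \<i>)) = 1"
      using Q_exp[of 0] Q_exp[of "2 * of_real pi * \<i>"] False by (simp add: exp_two_pi_i)
    then obtain k :: int where "- \<alpha> * (2 * pi) = of_int (2 * k) * pi"
      by (auto simp: exp_eq_1)
    then have "- \<alpha> * pi = of_int k * pi"
      by (simp add: mult.commute)
    then have \<alpha>: "- \<alpha> = of_int k"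
      using pi_gt_zero by (subst (asm) mult_cancel_right) auto
    have mono: "Q u = C * u powi k" if "u \<noteq> 0" for u
    proof -
      have "- complex_of_real \<alpha> = of_int k"
        by (metis \<alpha> of_real_minus of_real_of_int_eq)
      then have "Q (exp (Ln u)) = C * exp (of_int k * Ln u)"
        by (simp only: Q_exp)
      then show ?thesis
        using that exp_power_int[of "Ln u" k] by simp
    qed
    moreover have "c = of_real p powi k"
      using per[of 1] mono[of 1] mono[of "of_real p"] p False by simp
    ultimately show thesis
      by (intro that)
  qed
qed

lemma connected_punctured_plane: "connected (- {0::complex})"
  by (simp add: connected_punctured_universe)

lemma theta_quotient_holomorphic:
  assumes p: "0 < p" "p < 1" and "a \<noteq> 0"
  shows "(\<lambda>u. theta p (u / a)) holomorphic_on - {0}"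
  by (rule holomorphic_on_compose_gen[OF _ theta_holomorphic[OF p], unfolded o_def])
    (use \<open>a \<noteq> 0\<close> in \<open>auto intro!: holomorphic_intros\<close>)

text \<open>
  One zero is split off: \<open>\<phi>\<close> vanishes together with \<open>a\<close> on all points congruent to
  \<open>a\<close>, which are the simple zeros of \<open>\<theta>(u / a)\<close>, so the quotient is holomorphic. Its degree is
  smaller by one and its multiplier is divided by that of the theta factor.
\<close>

lemma theta_divides:
  fixes \<phi> :: "complex \<Rightarrow> complex"
  assumes p: "0 < p" "p < 1" and "a \<noteq> 0" and hol: "\<phi> holomorphic_on - {0}" and "c \<noteq> 0"
    and per: "\<And>u. u \<noteq> 0 \<Longrightarrow> \<phi> (of_real p * u) * u ^ Suc N = c * \<phi> u" and "\<phi> a = 0"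
  obtains \<psi> where "\<psi> holomorphic_on - {0}" and "\<And>u. u \<noteq> 0 \<Longrightarrow> \<phi> u = \<psi> u * theta p (u / a)"
    and "\<And>u. u \<noteq> 0 \<Longrightarrow> \<psi> (of_real p * u) * u ^ N = - c / a * \<psi> u"
proof -
  note hol\<theta> = theta_quotient_holomorphic[OF p \<open>a \<noteq> 0\<close>]
  have "\<phi> u = 0 \<and> deriv (\<lambda>u. theta p (u / a)) u \<noteq> 0" if u: "u \<noteq> 0" and zero: "theta p (u / a) = 0" for u
  proof
    obtain n :: int where "u / a = of_real p powi n"
      using zero u \<open>a \<noteq> 0\<close> theta_eq_0_iff[OF p] by auto
    then have u_eq: "u = of_real p powi n * a"
      using \<open>a \<noteq> 0\<close> by (simp add: field_simps)
    have step: "\<phi> (of_real p * v) = 0 \<longleftrightarrow> \<phi> v = 0" if "v \<noteq> 0" for v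
      using per[OF that] that \<open>c \<noteq> 0\<close> by auto
    have "\<phi> (of_real p powi i * a) = 0" for i :: int
    proof (induction i rule: int_induct[of _ 0])
      case base
      then show ?case using \<open>\<phi> a = 0\<close> by simp
    next
      case (step1 i)
      then show ?case
        using step[of "of_real p powi i * a"] p \<open>a \<noteq> 0\<close> by (simp add: power_int_add mult_ac)
    next
      case (step2 i)
      then show ?case
        using step[of "of_real p powi (i - 1) * a"] p \<open>a \<noteq> 0\<close> by (simp add: power_int_diff mult_ac)
    qed
    then show "\<phi> u = 0" by (simp add: u_eq)
    have "((\<lambda>u. theta p (u / a)) has_field_derivative deriv (theta p) (u / a) * (1 / a)) (at u)"
      using u \<open>a \<noteq> 0\<close>
      by (intro DERIV_chain2[OF theta_has_derivative[OF p]] DERIV_cdivide DERIV_ident) auto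
    then have "deriv (\<lambda>u. theta p (u / a)) u = deriv (theta p) (u / a) * (1 / a)"
      by (rule DERIV_imp_deriv)
    then show "deriv (\<lambda>u. theta p (u / a)) u \<noteq> 0"
      using deriv_theta_nonzero[OF p _ zero] u \<open>a \<noteq> 0\<close> by simp
  qed
  then obtain \<psi> where \<psi>: "\<psi> holomorphic_on - {0}"
    and \<phi>_eq: "\<And>u. u \<noteq> 0 \<Longrightarrow> \<phi> u = \<psi> u * theta p (u / a)"
    using holomorphic_quotient_simple_zeros[OF _ hol hol\<theta>] by auto
  have per_\<psi>: "\<psi> (of_real p * u) * u ^ N = - c / a * \<psi> u" if "u \<noteq> 0" for u
  proof -
    have "\<psi> (of_real p * u) * u ^ N + c / a * \<psi> u = 0"
    proof (rule holomorphic_mult_eq_0[where f = "\<lambda>u. \<psi> (of_real p * u) * u ^ N + c / a * \<psi> u",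
          OF _ connected_punctured_plane _ hol\<theta>])
      have "(\<lambda>u. \<psi> (of_real p * u)) holomorphic_on - {0}"
        by (rule holomorphic_on_compose_gen[OF _ \<psi>, unfolded o_def])
          (use p in \<open>auto intro!: holomorphic_intros\<close>)
      then show "(\<lambda>u. \<psi> (of_real p * u) * u ^ N + c / a * \<psi> u) holomorphic_on - {0}"
        by (intro holomorphic_intros \<psi>)
      show "(\<psi> (of_real p * u) * u ^ N + c / a * \<psi> u) * theta p (u / a) = 0" if "u \<in> - {0}" for u
      proof -
        have u: "u \<noteq> 0" using that by simp
        have "\<psi> (of_real p * u) * theta p (of_real p * (u / a)) * u ^ Suc N = c * (\<psi> u * theta p (u / a))"
          using per[OF u] \<phi>_eq[OF u] \<phi>_eq[of "of_real p * u"] u p by simp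
        also have "theta p (of_real p * (u / a)) = - theta p (u / a) / (u / a)"
          using u \<open>a \<noteq> 0\<close> by (intro theta_shift[OF p]) auto
        finally have eq: "c * (\<psi> u * theta p (u / a)) = - (a * (\<psi> (of_real p * u) * u ^ N * theta p (u / a)))"
          using u by (subst eq_commute) (simp add: mult_ac)
        have "(\<psi> (of_real p * u) * u ^ N + c / a * \<psi> u) * theta p (u / a) =
            (a * (\<psi> (of_real p * u) * u ^ N * theta p (u / a)) + c * (\<psi> u * theta p (u / a))) / a"
          using \<open>a \<noteq> 0\<close> by (simp add: field_simps)
        then show ?thesis
          by (simp add: eq)
      qed
      \<comment> \<open>At \<open>- a\<close> the theta factor does not vanish, because the powers of \<open>p\<close> are positive.\<close>
      have "- 1 \<noteq> (of_real p :: complex) powi n" for n :: int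
      proof
        assume "- 1 = (of_real p :: complex) powi n"
        then have "complex_of_real (- 1) = of_real (p powi n)" by simp
        then have "- 1 = p powi n" by (simp only: of_real_eq_iff)
        moreover have "p powi n > 0" using p by simp
        ultimately show False by simp
      qed
      then show "theta p (- a / a) \<noteq> 0"
        using \<open>a \<noteq> 0\<close> by (simp add: theta_eq_0_iff[OF p])
      show "- a \<in> - {0}"
        using \<open>a \<noteq> 0\<close> by simp
    qed (use that in auto)
    then show ?thesis by (simp add: add_eq_0_iff)
  qed
  from \<psi> \<phi>_eq per_\<psi> show thesis by (rule that)
qed

text \<open>
  A theta function of degree \<open>N\<close> with \<open>N\<close> incongruent zeros is determined by them up to a
  constant and a monomial, and the product of the zeros is determined modulo powers of \<open>p\<close>.
  The zeros are split off one at a time; the last quotient has degree zero.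
\<close>

lemma theta_factorization:
  fixes \<phi> :: "complex \<Rightarrow> complex"
  assumes p: "0 < p" "p < 1" and "finite I" and "\<phi> holomorphic_on - {0}" and "c \<noteq> 0"
    and "\<And>u. u \<noteq> 0 \<Longrightarrow> \<phi> (of_real p * u) * u ^ card I = c * \<phi> u"
    and "\<And>i. i \<in> I \<Longrightarrow> a i \<noteq> 0" and "\<And>i. i \<in> I \<Longrightarrow> \<phi> (a i) = 0"
    and "\<And>i i' n. i \<in> I \<Longrightarrow> i' \<in> I \<Longrightarrow> a i = a i' * of_real p powi n \<Longrightarrow> i = i'"
  obtains C and n :: int
  where "\<And>u. u \<noteq> 0 \<Longrightarrow> \<phi> u = C * u powi n * (\<Prod>i\<in>I. theta p (u / a i))"
    and "C \<noteq> 0 \<Longrightarrow> c = (- 1) ^ card I * (\<Prod>i\<in>I. a i) * of_real p powi n"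
proof -
  have "\<exists>C n. (\<forall>u. u \<noteq> 0 \<longrightarrow> \<phi> u = C * u powi n * (\<Prod>i\<in>I. theta p (u / a i))) \<and>
    (C \<noteq> 0 \<longrightarrow> c = (- 1) ^ card I * (\<Prod>i\<in>I. a i) * of_real p powi n)"
    using assms(3-)
  proof (induction I arbitrary: \<phi> c rule: finite_induct)
    case empty
    then show ?case
      using multiplicative_period_monomial[OF p, of \<phi> c] by simp metis
  next
    case (insert i I)
    obtain \<psi> where \<psi>: "\<psi> holomorphic_on - {0}"
      and \<phi>_eq: "\<And>u. u \<noteq> 0 \<Longrightarrow> \<phi> u = \<psi> u * theta p (u / a i)"
      and per: "\<And>u. u \<noteq> 0 \<Longrightarrow> \<psi> (of_real p * u) * u ^ card I = - c / a i * \<psi> u"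
      using theta_divides[OF p, of "a i" \<phi> c "card I"] insert.prems insert.hyps by auto
    have "\<psi> (a k) = 0" if "k \<in> I" for k
    proof -
      have "theta p (a k / a i) \<noteq> 0"
      proof
        assume "theta p (a k / a i) = 0"
        moreover have "a k / a i \<noteq> 0"
          using insert.prems(4) that by simp
        ultimately obtain n :: int where "a k / a i = of_real p powi n"
          using theta_eq_0_iff[OF p] by blast
        then have "a k = a i * of_real p powi n"
          using insert.prems(4)[of i] by (simp add: field_simps)
        then have "k = i"
          using insert.prems(6) that by blast
        then show False
          using that insert.hyps by simp
      qed
      then show ?thesis
        using \<phi>_eq[of "a k"] insert.prems(4,5) that by auto
    qed
    then obtain C and n :: int
      where C: "\<And>u. u \<noteq> 0 \<Longrightarrow> \<psi> u = C * u powi n * (\<Prod>i\<in>I. theta p (u / a i))"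
        and n: "C \<noteq> 0 \<Longrightarrow> - c / a i = (- 1) ^ card I * (\<Prod>i\<in>I. a i) * of_real p powi n"
      using insert.IH[OF \<psi>, of "- c / a i"] per insert.prems(2,4,6) by auto
    have "c = (- 1) ^ card (insert i I) * (\<Prod>i\<in>insert i I. a i) * of_real p powi n" if "C \<noteq> 0"
      using n[OF that] insert.hyps insert.prems(4)[of i] by (simp add: field_simps minus_equation_iff[of c])
    moreover have "\<phi> u = C * u powi n * (\<Prod>i\<in>insert i I. theta p (u / a i))" if "u \<noteq> 0" for u
      using \<phi>_eq[OF that] C[OF that] insert.hyps by simp
    ultimately show ?case by blast
  qed
  then show thesis
    using that by blast
qed

section \<open>Gaussian theta series\<close>

definition periodized_gaussian :: "real \<Rightarrow> real \<Rightarrow> real" where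
  "periodized_gaussian lam x = (\<Sum>\<^sub>\<infinity>j::int. exp (- pi * lam * (x - of_int j)\<^sup>2))"

text \<open>
  The Laurent series of the terms \<open>exp (- \<pi> lam (n/N)\<^sup>2) u\<^sup>n\<close> with \<open>n\<close> congruent to \<open>m\<close>
  modulo \<open>N\<close>. Writing \<open>n = m - j N\<close> makes \<open>j\<close> the summation index of the periodized window.
\<close>

definition gauss_theta :: "nat \<Rightarrow> real \<Rightarrow> nat \<Rightarrow> complex \<Rightarrow> complex" where
  "gauss_theta N lam m u =
     (\<Sum>\<^sub>\<infinity>j::int. of_real (exp (- pi * lam * (real m / real N - of_int j)\<^sup>2)) * u powi (int m - j * int N))"

text \<open>
  The point attached to a time-frequency pair. The time coordinate \<open>k\<close> is real, because a point
  that is incongruent to all the points with integral \<open>k\<close> is needed in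
  \<open>not_injective_if_abel\<close>.
\<close>

definition gabor_node :: "nat \<Rightarrow> real \<Rightarrow> real \<Rightarrow> int \<Rightarrow> complex" where
  "gabor_node N lam k l = exp (of_real (2 * pi * lam * k / (real N)\<^sup>2) - 2 * of_real pi * \<i> * of_int l / of_nat N)"

lemma exp_2pi_i_int: "exp (2 * of_real pi * \<i> * of_int n :: complex) = 1"
  using exp_integer_2pi[of "of_int n"] by (simp add: mult_ac)

lemma summable_exp_neg_abs_int: "(\<lambda>j::int. exp (- \<bar>real_of_int j\<bar>)) summable_on UNIV"
proof -
  have nat: "(\<lambda>n::nat. exp (- real n)) summable_on UNIV"
  proof -
    have "summable (\<lambda>n. exp (- 1 :: real) ^ n)"
      by (rule summable_geometric) simp
    then have "summable (\<lambda>n. exp (- real n))"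
      by (simp add: exp_of_nat_mult[symmetric])
    then show ?thesis
      by (subst summable_on_UNIV_nonneg_real_iff) auto
  qed
  have "(\<lambda>j::int. exp (- \<bar>real_of_int j\<bar>)) summable_on range int"
    by (subst summable_on_reindex) (auto simp: o_def nat)
  moreover have "(\<lambda>j::int. exp (- \<bar>real_of_int j\<bar>)) summable_on range (\<lambda>n. - int n)"
    by (subst summable_on_reindex) (auto simp: o_def nat inj_on_def)
  ultimately have "(\<lambda>j::int. exp (- \<bar>real_of_int j\<bar>)) summable_on (range int \<union> range (\<lambda>n. - int n))"
    by (rule summable_on_union)
  moreover have "range int \<union> range (\<lambda>n. - int n) = UNIV"
    by (auto simp: image_iff) (metis int_cases2)
  ultimately show ?thesis by simp
qed

text \<open>
  With \<open>y = \<bar>x - j\<bar>\<close>, completing the square in \<open>- \<pi> lam y\<^sup>2 + (s + 1) y\<close> bounds it by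
  its maximum \<open>(s + 1)\<^sup>2 / (4 \<pi> lam)\<close>; the additional \<open>y\<close> leaves room for geometric decay.
\<close>

lemma gaussian_term_bound:
  fixes x s :: real and j :: int
  assumes "lam > 0"
  shows "exp (- pi * lam * (x - of_int j)\<^sup>2) * exp (s * \<bar>x - of_int j\<bar>)
    \<le> exp ((s + 1)\<^sup>2 / (4 * pi * lam)) * exp \<bar>x\<bar> * exp (- \<bar>real_of_int j\<bar>)"
proof -
  define y where "y = \<bar>x - of_int j\<bar>"
  have pos: "pi * lam > 0" using assms by simp
  have square: "a * y\<^sup>2 - t * y + t\<^sup>2 / (4 * a) = (2 * a * y - t)\<^sup>2 / (4 * a)" if "a > 0" for a t :: real
    using that by (simp add: power2_eq_square field_simps)
  have "pi * lam * y\<^sup>2 - (s + 1) * y + (s + 1)\<^sup>2 / (4 * (pi * lam)) \<ge> 0"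
    unfolding square[OF pos] using pos by simp
  then have "- (pi * lam * y\<^sup>2) + s * y \<le> (s + 1)\<^sup>2 / (4 * pi * lam) - y"
    by (simp add: algebra_simps)
  moreover have "- y \<le> \<bar>x\<bar> - \<bar>real_of_int j\<bar>"
    unfolding y_def by linarith
  ultimately have "- (pi * lam * y\<^sup>2) + s * y \<le> (s + 1)\<^sup>2 / (4 * pi * lam) + \<bar>x\<bar> - \<bar>real_of_int j\<bar>"
    by linarith
  then have "exp (- (pi * lam * y\<^sup>2) + s * y) \<le> exp ((s + 1)\<^sup>2 / (4 * pi * lam) + \<bar>x\<bar> - \<bar>real_of_int j\<bar>)"
    by simp
  then show ?thesis
    by (simp add: exp_add exp_diff exp_minus y_def field_simps)
qed

lemma summable_gaussian_int:
  assumes "lam > 0"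
  shows "(\<lambda>j::int. exp (- pi * lam * (x - of_int j)\<^sup>2)) summable_on UNIV"
proof (rule summable_on_comparison_test)
  show "(\<lambda>j::int. exp ((0 + 1)\<^sup>2 / (4 * pi * lam)) * exp \<bar>x\<bar> * exp (- \<bar>real_of_int j\<bar>)) summable_on UNIV"
    by (intro summable_on_cmult_right summable_exp_neg_abs_int)
  show "exp (- pi * lam * (x - of_int j)\<^sup>2) \<le> exp ((0 + 1)\<^sup>2 / (4 * pi * lam)) * exp \<bar>x\<bar> * exp (- \<bar>real_of_int j\<bar>)" for j
    using gaussian_term_bound[OF assms, of x j 0] by simp
qed auto

lemma periodized_gaussian_pos: "lam > 0 \<Longrightarrow> periodized_gaussian lam x > 0"
proof -
  assume "lam > 0"
  then have "(\<Sum>j\<in>{0::int}. exp (- pi * lam * (x - of_int j)\<^sup>2)) \<le> periodized_gaussian lam x"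
    unfolding periodized_gaussian_def
    by (intro finite_sum_le_infsum summable_gaussian_int) auto
  moreover have "(\<Sum>j\<in>{0::int}. exp (- pi * lam * (x - of_int j)\<^sup>2)) > 0"
    by simp
  ultimately show ?thesis by linarith
qed

lemma infsum_gaussian: "lam > 0 \<Longrightarrow> (\<Sum>\<^sub>\<infinity>j::int. gaussian lam (x - of_int j)) = of_real (periodized_gaussian lam x)"
  unfolding gaussian_def periodized_gaussian_def
  by (intro infsumI has_sum_of_real has_sum_infsum summable_gaussian_int)

lemma periodized_gaussian_add_int: "periodized_gaussian lam (x + of_int d) = periodized_gaussian lam x"
  unfolding periodized_gaussian_def
  by (rule infsum_reindex_bij_witness[of _ "\<lambda>j. j + d" "\<lambda>j. j - d"]) (auto simp: algebra_simps)

lemma vec_at_sample_periodization: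
  assumes "N \<ge> 1" "lam > 0"
  shows "vec_at N (sample_periodization N (gaussian lam)) i = of_real (periodized_gaussian lam (of_int i / real N))"
proof -
  have "nat (i mod int N) < N"
    using assms by (simp add: nat_less_iff)
  then have "vec_at N (sample_periodization N (gaussian lam)) i =
      of_real (periodized_gaussian lam (real (nat (i mod int N)) / real N))"
    using assms by (simp add: vec_at_def sample_periodization_def infsum_gaussian)
  also have "real (nat (i mod int N)) / real N = of_int i / real N + of_int (- (i div int N))"
  proof -
    have "of_int i = real_of_int (i div int N * int N + i mod int N)" by simp
    then have "of_int i = of_int (i div int N) * real N + of_int (i mod int N)"
      by (simp only: of_int_add of_int_mult of_int_of_nat_eq)
    moreover have "real (nat (i mod int N)) = of_int (i mod int N)"
      using assms by simp
    ultimately show ?thesis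
      using assms by (simp add: field_simps)
  qed
  finally show ?thesis
    by (simp only: periodized_gaussian_add_int)
qed

context
  fixes N :: nat and lam :: real
  assumes N: "N \<ge> 1" and lam: "lam > 0"
begin

text \<open>
  The bound depends on \<open>u\<close> only through \<open>R\<close>, which makes the series converge uniformly on
  annuli.
\<close>

lemma gauss_theta_term_bound:
  fixes u :: complex
  assumes "R \<ge> 1" "1 / R \<le> norm u" "norm u \<le> R"
  shows "norm (of_real (exp (- pi * lam * (real m / real N - of_int j)\<^sup>2)) * u powi (int m - j * int N))
    \<le> exp ((real N * ln R + 1)\<^sup>2 / (4 * pi * lam)) * exp (real m / real N) * exp (- \<bar>real_of_int j\<bar>)"
proof -
  define x where "x = real m / real N"
  have u: "norm u > 0"
    using assms by (intro less_le_trans[OF _ assms(2)]) auto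
  have "\<bar>ln (norm u)\<bar> \<le> ln R"
  proof -
    have "ln (norm u) \<le> ln R" using u assms by simp
    moreover have "ln (1 / R) \<le> ln (norm u)" using u assms by (subst ln_le_cancel_iff) auto
    moreover have "ln (1 / R) = - ln R" using assms by (simp add: ln_div)
    ultimately show ?thesis by linarith
  qed
  have n: "of_int (int m - j * int N) = real N * (x - of_int j)"
    using N by (simp add: x_def field_simps)
  have "norm (u powi (int m - j * int N)) = exp (of_int (int m - j * int N) * ln (norm u))"
    using u exp_power_int[of "ln (norm u)" "int m - j * int N"] by (simp add: norm_power_int)
  also have "\<dots> \<le> exp (real N * ln R * \<bar>x - of_int j\<bar>)"
  proof -
    have "of_int (int m - j * int N) * ln (norm u) \<le> \<bar>of_int (int m - j * int N) * ln (norm u)\<bar>"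
      by (rule abs_ge_self)
    also have "\<dots> = real N * \<bar>x - of_int j\<bar> * \<bar>ln (norm u)\<bar>"
      unfolding n by (simp add: abs_mult)
    also have "\<dots> \<le> real N * \<bar>x - of_int j\<bar> * ln R"
      by (intro mult_left_mono) (use \<open>\<bar>ln (norm u)\<bar> \<le> ln R\<close> in auto)
    finally show ?thesis by (simp add: mult_ac)
  qed
  finally have "exp (- pi * lam * (x - of_int j)\<^sup>2) * norm (u powi (int m - j * int N)) \<le>
      exp (- pi * lam * (x - of_int j)\<^sup>2) * exp (real N * ln R * \<bar>x - of_int j\<bar>)"
    by (intro mult_left_mono) auto
  also have "\<dots> \<le> exp ((real N * ln R + 1)\<^sup>2 / (4 * pi * lam)) * exp \<bar>x\<bar> * exp (- \<bar>real_of_int j\<bar>)"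
    by (rule gaussian_term_bound[OF lam])
  finally show ?thesis
    by (simp add: norm_mult x_def)
qed

lemma gauss_theta_holomorphic: "gauss_theta N lam m holomorphic_on - {0}"
proof -
  have "gauss_theta N lam m field_differentiable at z" if "z \<noteq> 0" for z
  proof -
    define R where "R = 1 + 2 * norm z + 2 / norm z"
    define r where "r = norm z / 2"
    have "r > 0" using that by (simp add: r_def)
    have "R \<ge> 1" by (simp add: R_def)
    have "1 / R \<le> norm z / 2"
    proof -
      have "2 / norm z \<le> R" unfolding R_def by (simp add: add_nonneg_nonneg)
      then show ?thesis using that \<open>R \<ge> 1\<close> by (simp add: field_simps)
    qed
    have range: "1 / R \<le> norm u" "norm u \<le> R" if "u \<in> cball z r" for u
    proof -
      have "norm (z - u) \<le> norm z / 2" using that by (simp add: dist_norm r_def)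
      then have "norm z / 2 \<le> norm u" "norm u \<le> 3 * norm z / 2"
        using norm_triangle_ineq2[of z u] norm_triangle_ineq2[of u z] by (simp_all add: norm_minus_commute)
      moreover have "3 * norm z / 2 \<le> R"
      proof -
        have "2 / norm z \<ge> 0" "norm z \<ge> 0" by simp_all
        then show ?thesis unfolding R_def by linarith
      qed
      ultimately show "1 / R \<le> norm u" "norm u \<le> R"
        using \<open>1 / R \<le> norm z / 2\<close> by linarith+
    qed
    have lim: "uniform_limit (cball z r)
        (\<lambda>J u. \<Sum>j\<in>J. of_real (exp (- pi * lam * (real m / real N - of_int j)\<^sup>2)) * u powi (int m - j * int N))
        (gauss_theta N lam m) (finite_subsets_at_top UNIV)"
      unfolding gauss_theta_def
    proof (rule Weierstrass_m_test_general)
      show "(\<lambda>j. exp ((real N * ln R + 1)\<^sup>2 / (4 * pi * lam)) * exp (real m / real N) * exp (- \<bar>real_of_int j\<bar>)) summable_on UNIV"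
        by (intro summable_on_cmult_right summable_exp_neg_abs_int)
    qed (use gauss_theta_term_bound[OF \<open>R \<ge> 1\<close> range] in auto)
    have nz: "u \<noteq> 0" if "u \<in> cball z r" for u
      using that \<open>z \<noteq> 0\<close> by (auto simp: r_def)
    have hol: "(\<lambda>u. \<Sum>j\<in>J. of_real (exp (- pi * lam * (real m / real N - of_int j)\<^sup>2)) * u powi (int m - j * int N))
        holomorphic_on cball z r" for J
      using nz by (intro holomorphic_intros) auto
    have "gauss_theta N lam m holomorphic_on ball z r"
    proof (rule holomorphic_uniform_limit[OF _ lim])
      show "\<forall>\<^sub>F J in finite_subsets_at_top UNIV.
          continuous_on (cball z r) (\<lambda>u. \<Sum>j\<in>J. of_real (exp (- pi * lam * (real m / real N - of_int j)\<^sup>2)) * u powi (int m - j * int N)) \<and>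
          (\<lambda>u. \<Sum>j\<in>J. of_real (exp (- pi * lam * (real m / real N - of_int j)\<^sup>2)) * u powi (int m - j * int N)) holomorphic_on ball z r"
        by (intro always_eventually allI conjI holomorphic_on_imp_continuous_on[OF hol] holomorphic_on_subset[OF hol]) auto
    qed auto
    then show ?thesis
      using \<open>r > 0\<close> by (intro holomorphic_on_imp_differentiable_at[of _ "ball z r"]) auto
  qed
  then show ?thesis
    by (auto simp: holomorphic_on_def intro: field_differentiable_at_within)
qed

text \<open>
  With \<open>x = m / N - j\<close>, the identity \<open>x\<^sup>2 + 2 x = (x + 1)\<^sup>2 - 1\<close> turns the term with index
  \<open>j\<close> at \<open>p u\<close> into the term with index \<open>j - 1\<close> at \<open>u\<close>.
\<close>

lemma gauss_theta_shift:
  assumes "u \<noteq> 0"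
  shows "gauss_theta N lam m (of_real (exp (- 2 * pi * lam / real N)) * u) * u ^ N
    = of_real (exp (pi * lam)) * gauss_theta N lam m u"
proof -
  define t where "t u j = of_real (exp (- pi * lam * (real m / real N - of_int j)\<^sup>2)) * u powi (int m - j * int N)"
    for u :: complex and j
  have step: "t (of_real (exp (- 2 * pi * lam / real N)) * u) j * u ^ N = of_real (exp (pi * lam)) * t u (j - 1)" for j
  proof -
    have "exp (- 2 * pi * lam / real N) powi (int m - j * int N) = exp (- 2 * pi * lam * (real m / real N - of_int j))"
      using N by (subst exp_power_int) (simp add: field_simps)
    then have e1: "complex_of_real (exp (- 2 * pi * lam / real N)) powi (int m - j * int N) =
        of_real (exp (- 2 * pi * lam * (real m / real N - of_int j)))"
      by (metis of_real_power_int)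
    have e2: "u powi (int m - j * int N) * u ^ N = u powi (int m - (j - 1) * int N)"
      using assms by (simp add: power_int_add[symmetric] power_int_of_nat[symmetric] algebra_simps del: power_int_of_nat)
    have "exp (- pi * lam * (real m / real N - of_int j)\<^sup>2) * exp (- 2 * pi * lam * (real m / real N - of_int j))
        = exp (pi * lam) * exp (- pi * lam * (real m / real N - of_int (j - 1))\<^sup>2)"
      by (simp add: exp_add[symmetric] power2_eq_square algebra_simps)
    then have e3: "complex_of_real (exp (- pi * lam * (real m / real N - of_int j)\<^sup>2)) *
          of_real (exp (- 2 * pi * lam * (real m / real N - of_int j)))
        = of_real (exp (pi * lam)) * of_real (exp (- pi * lam * (real m / real N - of_int (j - 1))\<^sup>2))"
      by (simp only: of_real_mult[symmetric])
    have "t (of_real (exp (- 2 * pi * lam / real N)) * u) j * u ^ N =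
        (of_real (exp (- pi * lam * (real m / real N - of_int j)\<^sup>2)) *
          of_real (exp (- 2 * pi * lam / real N)) powi (int m - j * int N)) *
        (u powi (int m - j * int N) * u ^ N)"
      by (simp only: t_def power_int_mult_distrib mult_ac)
    also have "\<dots> = of_real (exp (pi * lam)) * t u (j - 1)"
      unfolding e1 e2 e3 by (simp only: t_def mult_ac)
    finally show ?thesis .
  qed
  have "gauss_theta N lam m (of_real (exp (- 2 * pi * lam / real N)) * u) * u ^ N =
      (\<Sum>\<^sub>\<infinity>j. t (of_real (exp (- 2 * pi * lam / real N)) * u) j * u ^ N)"
    unfolding gauss_theta_def t_def by (rule infsum_cmult_left'[symmetric])
  also have "\<dots> = (\<Sum>\<^sub>\<infinity>j. of_real (exp (pi * lam)) * t u (j - 1))"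
    by (simp only: step)
  also have "\<dots> = of_real (exp (pi * lam)) * (\<Sum>\<^sub>\<infinity>j. t u (j - 1))"
    by (rule infsum_cmult_right')
  also have "(\<Sum>\<^sub>\<infinity>j. t u (j - 1)) = (\<Sum>\<^sub>\<infinity>j. t u j)"
    by (rule infsum_reindex_bij_witness[of _ "\<lambda>j. j + 1" "\<lambda>j. j - 1"]) auto
  finally show ?thesis
    by (simp add: gauss_theta_def t_def)
qed

text \<open>
  Completing the square translates the Gaussian by \<open>k / N\<close>. The modulation
  \<open>exp (- 2 \<pi> \<i> l (m - j N) / N)\<close> does not depend on \<open>j\<close> because \<open>l\<close> is an integer.
\<close>

lemma gauss_theta_at_node:
  "gauss_theta N lam m (gabor_node N lam k l) =
     of_real (exp (pi * lam * k\<^sup>2 / (real N)\<^sup>2)) * of_real (periodized_gaussian lam ((real m - k) / real N)) *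
     exp (- 2 * of_real pi * \<i> * of_int l * of_nat m / of_nat N)"
proof -
  let ?e = "exp (- 2 * of_real pi * \<i> * of_int l * of_nat m / of_nat N)"
  have term_eq: "of_real (exp (- pi * lam * (real m / real N - of_int j)\<^sup>2)) * gabor_node N lam k l powi (int m - j * int N)
      = of_real (exp (pi * lam * k\<^sup>2 / (real N)\<^sup>2)) * of_real (exp (- pi * lam * ((real m - k) / real N - of_int j)\<^sup>2)) * ?e" for j
  proof -
    have "gabor_node N lam k l powi (int m - j * int N) =
        exp (of_int (int m - j * int N) * of_real (2 * pi * lam * k / (real N)\<^sup>2) +
          - 2 * of_real pi * \<i> * of_int l * of_nat m / of_nat N + 2 * of_real pi * \<i> * of_int (l * j))"
      unfolding gabor_node_def exp_power_int using N by (simp add: field_simps)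
    also have "\<dots> = exp (of_int (int m - j * int N) * of_real (2 * pi * lam * k / (real N)\<^sup>2)) * ?e"
    proof -
      show ?thesis by (simp only: exp_add exp_2pi_i_int mult_1_right)
    qed
    also have "of_int (int m - j * int N) * complex_of_real (2 * pi * lam * k / (real N)\<^sup>2) =
        of_real (2 * pi * lam * k / real N * (real m / real N - of_int j))"
      using N by (simp add: field_simps power2_eq_square)
    also have "exp (complex_of_real (2 * pi * lam * k / real N * (real m / real N - of_int j))) =
        of_real (exp (2 * pi * lam * k / real N * (real m / real N - of_int j)))"
      by (rule exp_of_real)
    finally have node: "gabor_node N lam k l powi (int m - j * int N) =
        of_real (exp (2 * pi * lam * k / real N * (real m / real N - of_int j))) * ?e" .
    have "of_real (exp (- pi * lam * (real m / real N - of_int j)\<^sup>2) * exp (2 * pi * lam * k / real N * (real m / real N - of_int j)))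
        = complex_of_real (exp (pi * lam * k\<^sup>2 / (real N)\<^sup>2) * exp (- pi * lam * ((real m - k) / real N - of_int j)\<^sup>2))"
      using N by (simp add: exp_add[symmetric] power2_eq_square field_simps)
    then show ?thesis
      unfolding node by (simp only: of_real_mult mult.assoc[symmetric])
  qed
  have "((\<lambda>j. of_real (exp (- pi * lam * ((real m - k) / real N - of_int j)\<^sup>2)) :: complex) has_sum
      of_real (periodized_gaussian lam ((real m - k) / real N))) UNIV"
    unfolding periodized_gaussian_def
    by (intro has_sum_of_real has_sum_infsum summable_gaussian_int lam)
  from has_sum_cmult_left[OF has_sum_cmult_right[OF this]] show ?thesis
    unfolding gauss_theta_def term_eq by (rule infsumI)
qed

end

section \<open>Frames and linear systems\<close>

text \<open>
  The bounds are the extremal values of the quadratic form on the compact unit sphere. The sphere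
  is taken among sequences with values in the unit disc, which makes it compact in the product
  topology by Tychonoff's theorem.
\<close>

lemma injective_form_bounds:
  fixes c :: "'k \<Rightarrow> nat \<Rightarrow> complex"
  assumes "N \<ge> 1" "finite S"
    and inj: "\<And>x. (\<And>k. k \<in> S \<Longrightarrow> (\<Sum>m<N. x m * c k m) = 0) \<Longrightarrow> \<forall>m<N. x m = 0"
  obtains A B :: real where "A > 0" "B > 0"
    and "\<And>x. A * (\<Sum>m<N. (cmod (x m))\<^sup>2) \<le> (\<Sum>k\<in>S. (cmod (\<Sum>m<N. x m * c k m))\<^sup>2)"
    and "\<And>x. (\<Sum>k\<in>S. (cmod (\<Sum>m<N. x m * c k m))\<^sup>2) \<le> B * (\<Sum>m<N. (cmod (x m))\<^sup>2)"
proof -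
  define q :: "(nat \<Rightarrow> complex) \<Rightarrow> real" where "q x = (\<Sum>k\<in>S. (cmod (\<Sum>m<N. x m * c k m))\<^sup>2)" for x
  define r :: "(nat \<Rightarrow> complex) \<Rightarrow> real" where "r x = (\<Sum>m<N. (cmod (x m))\<^sup>2)" for x
  define sph where "sph = {x. (\<forall>i. x i \<in> cball 0 1) \<and> r x = 1}"
  have cont_q: "continuous_on UNIV q" and cont_r: "continuous_on UNIV r"
    unfolding q_def r_def by (intro continuous_intros continuous_on_product_coordinates)+
  have "compact {x::nat \<Rightarrow> complex. \<forall>i. x i \<in> cball 0 1}"
  proof -
    have "compactin (product_topology (\<lambda>_::nat. euclidean) UNIV) (PiE UNIV (\<lambda>_. cball (0::complex) 1))"
      by (subst compactin_PiE) auto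
    then show ?thesis
      by (simp add: euclidean_product_topology PiE_UNIV_domain Pi_def)
  qed
  moreover have "closed {x. r x = 1}"
    using continuous_closed_vimage[of "{1}" r] cont_r continuous_on_eq_continuous_at
    by (auto simp: vimage_def)
  ultimately have "compact sph"
    unfolding sph_def Collect_conj_eq by (rule compact_Int_closed)
  have "sph \<noteq> {}"
  proof -
    have "r (\<lambda>i. if i = 0 then 1 else 0) = (\<Sum>m<N. if m = 0 then 1 else 0)"
      unfolding r_def by (intro sum.cong) auto
    then have "(\<lambda>i. if i = 0 then 1 else 0) \<in> sph"
      using \<open>N \<ge> 1\<close> by (auto simp: sph_def)
    then show ?thesis by blast
  qed
  obtain x0 where x0: "x0 \<in> sph" "\<And>x. x \<in> sph \<Longrightarrow> q x0 \<le> q x"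
    using continuous_attains_inf[OF \<open>compact sph\<close> \<open>sph \<noteq> {}\<close> continuous_on_subset[OF cont_q]] by auto
  obtain x1 where x1: "x1 \<in> sph" "\<And>x. x \<in> sph \<Longrightarrow> q x \<le> q x1"
    using continuous_attains_sup[OF \<open>compact sph\<close> \<open>sph \<noteq> {}\<close> continuous_on_subset[OF cont_q]] by auto
  have q_nonneg: "q x \<ge> 0" for x
    unfolding q_def by (intro sum_nonneg) auto
  have "q x0 \<noteq> 0"
  proof
    assume "q x0 = 0"
    then have "(\<Sum>m<N. x0 m * c k m) = 0" if "k \<in> S" for k
      using that \<open>finite S\<close> by (auto simp: q_def sum_nonneg_eq_0_iff)
    then have "\<forall>m<N. x0 m = 0" by (rule inj)
    then have "r x0 = 0" by (simp add: r_def)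
    then show False using x0(1) by (simp add: sph_def)
  qed
  then have "q x0 > 0" using q_nonneg[of x0] by linarith
  have bounds: "q x0 * r x \<le> q x \<and> q x \<le> (q x1 + 1) * r x" for x
  proof (cases "r x = 0")
    case True
    then have "\<forall>m<N. x m = 0"
      by (auto simp: r_def sum_nonneg_eq_0_iff)
    then have "q x = 0" by (simp add: q_def)
    then show ?thesis using True by simp
  next
    case False
    have "r x \<ge> 0" unfolding r_def by (intro sum_nonneg) auto
    with False have "r x > 0" by simp
    define s where "s = sqrt (r x)"
    have s: "s > 0" "s\<^sup>2 = r x" using \<open>r x > 0\<close> by (auto simp: s_def)
    define y where "y i = (if i < N then x i / of_real s else 0)" for i
    have "r y = (\<Sum>m<N. (cmod (x m))\<^sup>2 / s\<^sup>2)"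
      unfolding r_def y_def using s by (intro sum.cong) (auto simp: norm_divide power_divide)
    also have "\<dots> = 1"
      using \<open>r x > 0\<close> by (simp add: sum_divide_distrib[symmetric] s(2)) (simp add: r_def)
    finally have "r y = 1" .
    have "cmod (y i) \<le> 1" for i
    proof (cases "i < N")
      case True
      then have "(cmod (y i))\<^sup>2 \<le> r y"
        unfolding r_def by (intro member_le_sum) auto
      then have "(cmod (y i))\<^sup>2 \<le> 1\<^sup>2" using \<open>r y = 1\<close> by simp
      then show ?thesis by (rule power2_le_imp_le) simp
    qed (simp add: y_def)
    then have "y \<in> sph" using \<open>r y = 1\<close> by (simp add: sph_def)
    have "q y = (\<Sum>k\<in>S. (cmod (\<Sum>m<N. x m * c k m))\<^sup>2 / s\<^sup>2)"
      unfolding q_def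
    proof (rule sum.cong)
      fix k
      have "(\<Sum>m<N. y m * c k m) = (\<Sum>m<N. x m * c k m) / of_real s"
        by (simp add: y_def sum_divide_distrib)
      then show "(cmod (\<Sum>m<N. y m * c k m))\<^sup>2 = (cmod (\<Sum>m<N. x m * c k m))\<^sup>2 / s\<^sup>2"
        using s by (simp add: norm_divide power_divide)
    qed auto
    also have "\<dots> = q x / r x"
      by (simp add: sum_divide_distrib[symmetric] s(2)) (simp add: q_def)
    finally have "q y * r x = q x" using \<open>r x > 0\<close> by simp
    moreover have "q x0 * r x \<le> q y * r x" "q y * r x \<le> (q x1 + 1) * r x"
      using x0(2)[OF \<open>y \<in> sph\<close>] x1(2)[OF \<open>y \<in> sph\<close>] \<open>r x > 0\<close> by (auto intro!: mult_right_mono)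
    ultimately show ?thesis by simp
  qed
  \<comment> \<open>The added \<open>1\<close> makes the upper constant positive.\<close>
  show thesis
  proof (rule that[of "q x0" "q x1 + 1"])
    show "q x0 > 0" by fact
    show "q x1 + 1 > 0" using q_nonneg[of x1] by simp
  qed (use bounds in \<open>auto simp: q_def r_def\<close>)
qed

lemma discrete_gabor_eq_sum:
  assumes "dim_vec f = N"
  shows "discrete_gabor N g f k l = (\<Sum>m<N. vec_index f m * (cnj (vec_at N g (int m - k)) *
        exp (- 2 * of_real pi * \<i> * of_int l * of_nat m / of_nat N)))"
  unfolding discrete_gabor_def by (intro sum.cong) (auto simp: vec_at_def mult.assoc)

lemma gabor_frame_iff_injective:
  assumes "N \<ge> 1"
  shows "gabor_frame N g K j l \<longleftrightarrow>
    (\<forall>f\<in>carrier_vec N. (\<forall>k\<in>{1..K}. discrete_gabor N g f (j k) (l k) = 0) \<longrightarrow> f = 0\<^sub>v N)"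
proof
  assume "gabor_frame N g K j l"
  then obtain A where A: "A > 0" "\<And>f. f \<in> carrier_vec N \<Longrightarrow>
      A * (euclid_norm f)\<^sup>2 \<le> (\<Sum>k=1..K. (cmod (discrete_gabor N g f (j k) (l k)))\<^sup>2)"
    unfolding gabor_frame_def by blast
  show "\<forall>f\<in>carrier_vec N. (\<forall>k\<in>{1..K}. discrete_gabor N g f (j k) (l k) = 0) \<longrightarrow> f = 0\<^sub>v N"
  proof (intro ballI impI)
    fix f assume f: "f \<in> carrier_vec N" "\<forall>k\<in>{1..K}. discrete_gabor N g f (j k) (l k) = 0"
    then have "A * (euclid_norm f)\<^sup>2 \<le> 0"
      using A(2)[OF f(1)] by simp
    then have "euclid_norm f = 0"
      using A(1) by (simp add: mult_le_0_iff)
    then have "vec_index f m = 0" if "m < N" for m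
      using that f(1) by (auto simp: euclid_norm_def L2_set_eq_0_iff)
    then show "f = 0\<^sub>v N"
      using f(1) by (intro eq_vecI) auto
  qed
next
  assume inj: "\<forall>f\<in>carrier_vec N. (\<forall>k\<in>{1..K}. discrete_gabor N g f (j k) (l k) = 0) \<longrightarrow> f = 0\<^sub>v N"
  define c where "c k m = cnj (vec_at N g (int m - j k)) *
        exp (- 2 * of_real pi * \<i> * of_int (l k) * of_nat m / of_nat N)" for k m
  have gabor: "discrete_gabor N g f (j k) (l k) = (\<Sum>m<N. vec_index f m * c k m)" if "f \<in> carrier_vec N" for f k
    using that by (subst discrete_gabor_eq_sum) (auto simp: c_def)
  have inj_c: "\<forall>m<N. x m = 0" if x: "\<And>k. k \<in> {1..K} \<Longrightarrow> (\<Sum>m<N. x m * c k m) = 0" for x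
  proof -
    have "Matrix.vec N x = 0\<^sub>v N"
      using inj x by (auto simp: gabor)
    then show ?thesis
      by (metis index_vec index_zero_vec(1))
  qed
  obtain A B :: real where AB: "A > 0" "B > 0"
    "\<And>x. A * (\<Sum>m<N. (cmod (x m))\<^sup>2) \<le> (\<Sum>k\<in>{1..K}. (cmod (\<Sum>m<N. x m * c k m))\<^sup>2)"
    "\<And>x. (\<Sum>k\<in>{1..K}. (cmod (\<Sum>m<N. x m * c k m))\<^sup>2) \<le> B * (\<Sum>m<N. (cmod (x m))\<^sup>2)"
    by (rule injective_form_bounds[OF assms finite_atLeastAtMost[of 1 K] inj_c]) (assumption | rule that)+
  have norm: "(euclid_norm f)\<^sup>2 = (\<Sum>m<N. (cmod (vec_index f m))\<^sup>2)" if "f \<in> carrier_vec N" for f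
    using that by (auto simp: euclid_norm_def L2_set_def sum_nonneg)
  show "gabor_frame N g K j l"
    unfolding gabor_frame_def
  proof (rule exI[of _ A], rule exI[of _ B], intro conjI ballI AB(1,2))
    fix f :: "complex Matrix.vec" assume f: "f \<in> carrier_vec N"
    show "A * (euclid_norm f)\<^sup>2 \<le> (\<Sum>k=1..K. (cmod (discrete_gabor N g f (j k) (l k)))\<^sup>2)"
      unfolding gabor[OF f] norm[OF f] by (rule AB(3))
    show "(\<Sum>k=1..K. (cmod (discrete_gabor N g f (j k) (l k)))\<^sup>2) \<le> B * (euclid_norm f)\<^sup>2"
      unfolding gabor[OF f] norm[OF f] by (rule AB(4))
  qed
qed

text \<open>
  Filled up with zero rows the system becomes square. Its last row is zero, so its determinant
  vanishes.
\<close>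

lemma underdetermined_system_solvable:
  fixes c :: "nat \<Rightarrow> nat \<Rightarrow> complex"
  assumes "K < N"
  obtains f where "f \<in> carrier_vec N" "f \<noteq> 0\<^sub>v N" "\<And>k. k < K \<Longrightarrow> (\<Sum>m<N. c k m * vec_index f m) = 0"
proof -
  define A where "A = Matrix.mat N N (\<lambda>(i, m). if i < K then c i m else 0)"
  have A: "A \<in> carrier_mat N N" by (simp add: A_def)
  have "transpose_mat A *\<^sub>v unit_vec N (N - 1) = 0\<^sub>v N"
    using assms by (intro eq_vecI) (auto simp: A_def)
  moreover have "unit_vec N (N - 1) \<noteq> (0\<^sub>v N :: complex Matrix.vec)"
    using assms by simp
  ultimately have "\<exists>v. v \<in> carrier_vec N \<and> v \<noteq> 0\<^sub>v N \<and> transpose_mat A *\<^sub>v v = 0\<^sub>v N"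
    by (intro exI[of _ "unit_vec N (N - 1)"]) simp
  then have "Determinant.det (transpose_mat A) = 0"
    using det_0_iff_vec_prod_zero[of "transpose_mat A" N] A by simp
  then have "Determinant.det A = 0"
    using Determinant.det_transpose[OF A] by simp
  then obtain v where v: "v \<in> carrier_vec N" "v \<noteq> 0\<^sub>v N" "A *\<^sub>v v = 0\<^sub>v N"
    using det_0_iff_vec_prod_zero[OF A] by blast
  have "(\<Sum>m<N. c k m * vec_index v m) = 0" if "k < K" for k
  proof -
    have "vec_index (A *\<^sub>v v) k = (\<Sum>m<N. c k m * vec_index v m)"
      using that assms v(1) by (auto simp: A_def scalar_prod_def atLeast0LessThan intro!: sum.cong)
    then show ?thesis using v(3) that assms by simp
  qed
  with v(1,2) show thesis by (rule that)
qed

section \<open>The theta function of a vector\<close>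

definition theta_period :: "nat \<Rightarrow> real \<Rightarrow> real" where
  "theta_period N lam = exp (- 2 * pi * lam / real N)"

definition gabor_theta :: "nat \<Rightarrow> real \<Rightarrow> complex Matrix.vec \<Rightarrow> complex \<Rightarrow> complex" where
  "gabor_theta N lam f u = (\<Sum>m<N. vec_index f m * gauss_theta N lam m u)"

lemma sum_roots_of_unity_int:
  fixes d :: int
  assumes "N \<ge> 1" "\<not> int N dvd d"
  shows "(\<Sum>l<N. exp (2 * of_real pi * \<i> * of_int (int l * d) / of_nat N) :: complex) = 0"
proof -
  define z where "z = exp (2 * of_real pi * \<i> * of_int d / of_nat N :: complex)"
  have "z ^ l = exp (2 * of_real pi * \<i> * of_int (int l * d) / of_nat N)" for l
    unfolding z_def exp_of_nat_mult[symmetric] by (simp add: mult_ac)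
  moreover have "z ^ N = 1"
    unfolding z_def exp_of_nat_mult[symmetric] using assms exp_2pi_i_int[of d] by simp
  moreover have "z \<noteq> 1"
  proof
    assume "z = 1"
    then obtain n :: int where "2 * pi * of_int d / real N = of_int (2 * n) * pi"
      by (auto simp: z_def exp_eq_1)
    then have "real_of_int d = of_int (n * int N)"
      using assms by (simp add: field_simps)
    then have "d = n * int N" by (simp only: of_int_eq_iff)
    with assms show False by simp
  qed
  ultimately show ?thesis
    using geometric_sum[of z N] by simp
qed

lemma gabor_node_nonzero [simp]: "gabor_node N lam k l \<noteq> 0"
  by (simp add: gabor_node_def)

lemma gabor_node_mult: "gabor_node N lam k l * gabor_node N lam k' l' = gabor_node N lam (k + k') (l + l')"
  unfolding gabor_node_def exp_add[symmetric]
  by (rule arg_cong[of _ _ exp]) (simp add: add_divide_distrib algebra_simps)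

lemma gabor_node_prod:
  "finite I \<Longrightarrow> (\<Prod>i\<in>I. gabor_node N lam (k i) (l i)) = gabor_node N lam (\<Sum>i\<in>I. k i) (\<Sum>i\<in>I. l i)"
  by (induction I rule: finite_induct) (auto simp: gabor_node_mult, simp add: gabor_node_def)

lemma gabor_node_real: "gabor_node N lam k 0 = of_real (exp (2 * pi * lam * k / (real N)\<^sup>2))"
  by (simp only: gabor_node_def exp_of_real of_int_0 mult_zero_right div_0 diff_zero)

lemma norm_gabor_node: "norm (gabor_node N lam k l) = exp (2 * pi * lam * k / (real N)\<^sup>2)"
  by (simp add: gabor_node_def norm_exp_eq_Re Re_divide_of_nat)

context
  fixes N :: nat and lam :: real
  assumes N: "N \<ge> 1" and lam: "lam > 0"
begin

lemma theta_period_bounds: "0 < theta_period N lam" "theta_period N lam < 1"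
  using N lam by (auto simp: theta_period_def)

lemma theta_period_powi: "of_real (theta_period N lam) powi n = gabor_node N lam (- of_int n * real N) 0"
proof -
  have "theta_period N lam powi n = exp (2 * pi * lam * (- of_int n * real N) / (real N)\<^sup>2)"
    unfolding theta_period_def exp_power_int using N by (simp add: power2_eq_square field_simps)
  then have "complex_of_real (theta_period N lam powi n) = of_real (exp (2 * pi * lam * (- of_int n * real N) / (real N)\<^sup>2))"
    by (rule arg_cong)
  then show ?thesis
    by (simp only: gabor_node_real of_real_power_int)
qed

lemma norm_gabor_node_eq_iff: "norm (gabor_node N lam k l) = norm (gabor_node N lam k' l') \<longleftrightarrow> k = k'"
  using N lam by (simp add: norm_gabor_node)

lemma gabor_node_eq_iff: "gabor_node N lam k l = gabor_node N lam k' l' \<longleftrightarrow> k = k' \<and> int N dvd l - l'"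
proof
  assume eq: "gabor_node N lam k l = gabor_node N lam k' l'"
  then have "k = k'"
    using norm_gabor_node_eq_iff by metis
  from eq obtain n :: int where "- (2 * pi * of_int l / real N) = - (2 * pi * of_int l' / real N) + of_int (2 * n) * pi"
    unfolding gabor_node_def exp_eq by (auto simp: complex_eq_iff Re_divide_of_nat Im_divide_of_nat)
  then have "2 * pi * of_int l' = 2 * pi * (of_int l + of_int n * real N)"
    using N by (simp add: field_simps)
  then have "real_of_int l' = of_int l + of_int n * real N"
    using pi_gt_zero by (subst (asm) mult_left_cancel) auto
  then have "real_of_int (l - l') = of_int (- n * int N)"
    by simp
  then have "l - l' = - n * int N" by (simp only: of_int_eq_iff)
  with \<open>k = k'\<close> show "k = k' \<and> int N dvd l - l'" by simp
next
  assume "k = k' \<and> int N dvd l - l'"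
  then obtain n where "k = k'" "l = l' + int N * n"
    by (metis add.commute diff_eq_eq dvd_def)
  moreover have "exp (2 * of_real pi * \<i> * of_int (int N * n) / of_nat N) = (1::complex)"
    using N exp_2pi_i_int[of n] by (simp add: mult.assoc)
  ultimately show "gabor_node N lam k l = gabor_node N lam k' l'"
    by (simp add: gabor_node_def exp_diff exp_add add_divide_distrib distrib_left)
qed

lemma exp_multiplier: "of_real (exp (pi * lam)) = gabor_node N lam ((real N)\<^sup>2 / 2) 0"
  unfolding gabor_node_real using N by (intro arg_cong[of _ _ of_real]) simp

text \<open>
  Abel's relation in coordinates. All factors other than the sign are nodes, so the relation
  equates two nodes up to sign: the moduli give \<open>N\<^sup>2 / 2 = S - n N\<close>, which makes \<open>N\<close> even
  and \<open>S\<close> a multiple of \<open>N\<close>, and the phases give that \<open>N\<close> divides \<open>L\<close>.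
\<close>

lemma abel_condition:
  fixes S L :: int
  shows "(\<exists>n. of_real (exp (pi * lam)) = (- 1) ^ N * gabor_node N lam (of_int S) L * of_real (theta_period N lam) powi n)
    \<longleftrightarrow> even N \<and> int N dvd S \<and> int N dvd L"
proof
  assume "\<exists>n. of_real (exp (pi * lam)) = (- 1) ^ N * gabor_node N lam (of_int S) L * of_real (theta_period N lam) powi n"
  then obtain n where "gabor_node N lam ((real N)\<^sup>2 / 2) 0 = (- 1) ^ N * gabor_node N lam (of_int S) L * of_real (theta_period N lam) powi n"
    by (auto simp: exp_multiplier)
  then have eq: "gabor_node N lam ((real N)\<^sup>2 / 2) 0 = (- 1) ^ N * gabor_node N lam (of_int S - of_int n * real N) L"
    by (simp add: theta_period_powi gabor_node_mult mult.assoc)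
  then have "norm (gabor_node N lam ((real N)\<^sup>2 / 2) 0) = norm (gabor_node N lam (of_int S - of_int n * real N) L)"
    by (simp add: norm_mult norm_power)
  then have "(real N)\<^sup>2 / 2 = of_int S - of_int n * real N"
    by (simp only: norm_gabor_node_eq_iff)
  then have "real_of_int (int N * int N) = of_int (2 * S - 2 * n * int N)"
    by (simp add: power2_eq_square)
  then have sq: "int N * int N = 2 * S - 2 * n * int N" by (simp only: of_int_eq_iff)
  then have "even (int N * int N)" by simp
  then have "even N" by simp
  then obtain M where M: "int N = 2 * M"
    by (metis even_of_nat dvd_def)
  have "S = int N * (M + n)" using sq M by (simp add: algebra_simps)
  moreover have "int N dvd 0 - L"
    using eq \<open>even N\<close> by (simp add: gabor_node_eq_iff)
  ultimately show "even N \<and> int N dvd S \<and> int N dvd L"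
    using \<open>even N\<close> by simp
next
  assume *: "even N \<and> int N dvd S \<and> int N dvd L"
  then obtain M where M: "int N = 2 * M"
    by (metis even_of_nat dvd_def)
  obtain t where t: "S = int N * t" using * by blast
  have "real N = 2 * of_int M" using arg_cong[OF M, of real_of_int] by simp
  then have "(real N)\<^sup>2 / 2 = of_int S - of_int (t - M) * real N"
    by (simp add: t power2_eq_square algebra_simps)
  moreover have "int N dvd 0 - L" using * by simp
  ultimately have "gabor_node N lam ((real N)\<^sup>2 / 2) 0 = gabor_node N lam (of_int S - of_int (t - M) * real N) L"
    by (simp only: gabor_node_eq_iff simp_thms)
  then have "of_real (exp (pi * lam)) = (- 1) ^ N * gabor_node N lam (of_int S) L * of_real (theta_period N lam) powi (t - M)"
    using * by (simp add: exp_multiplier theta_period_powi gabor_node_mult algebra_simps)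
  then show "\<exists>n. of_real (exp (pi * lam)) = (- 1) ^ N * gabor_node N lam (of_int S) L * of_real (theta_period N lam) powi n" ..
qed

lemma gabor_theta_holomorphic: "gabor_theta N lam f holomorphic_on - {0}"
  unfolding gabor_theta_def by (intro holomorphic_intros gauss_theta_holomorphic N lam)

lemma gabor_theta_shift:
  "u \<noteq> 0 \<Longrightarrow> gabor_theta N lam f (of_real (theta_period N lam) * u) * u ^ N = of_real (exp (pi * lam)) * gabor_theta N lam f u"
  unfolding gabor_theta_def sum_distrib_left sum_distrib_right theta_period_def
  by (intro sum.cong refl) (simp only: mult.assoc[of "vec_index f _"] mult.left_commute[of _ "vec_index f _"] gauss_theta_shift[OF N lam] not_False_eq_True)

lemma gabor_theta_at_node:
  assumes "f \<in> carrier_vec N"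
  shows "gabor_theta N lam f (gabor_node N lam (of_int k) l) =
    of_real (exp (pi * lam * (of_int k)\<^sup>2 / (real N)\<^sup>2)) * discrete_gabor N (sample_periodization N (gaussian lam)) f k l"
proof -
  have "discrete_gabor N (sample_periodization N (gaussian lam)) f k l =
     (\<Sum>m<N. vec_index f m * (of_real (periodized_gaussian lam ((real m - of_int k) / real N)) *
        exp (- 2 * of_real pi * \<i> * of_int l * of_nat m / of_nat N)))"
    using assms by (subst discrete_gabor_eq_sum) (simp_all add: vec_at_sample_periodization[OF N lam])
  then show ?thesis
    unfolding gabor_theta_def gauss_theta_at_node[OF N lam]
    by (simp only: sum_distrib_left mult_ac)
qed

lemma discrete_gabor_eq_0_iff:
  "f \<in> carrier_vec N \<Longrightarrow> discrete_gabor N (sample_periodization N (gaussian lam)) f k l = 0 \<longleftrightarrow>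
    gabor_theta N lam f (gabor_node N lam (of_int k) l) = 0"
  by (simp add: gabor_theta_at_node)

text \<open>
  If the theta function vanishes, so do the Gabor coefficients at \<open>(n, l)\<close> for all \<open>l\<close>.
  The inverse Fourier transform in \<open>l\<close> isolates the product of \<open>f\<^sub>n\<close> with the value of
  the window at \<open>0\<close>, which is positive.
\<close>

lemma gabor_theta_zero_imp_zero:
  assumes f: "f \<in> carrier_vec N" and zero: "\<And>u. u \<noteq> 0 \<Longrightarrow> gabor_theta N lam f u = 0"
  shows "f = 0\<^sub>v N"
proof -
  have "vec_index f n = 0" if n: "n < N" for n
  proof -
    define b where "b m = vec_index f m * of_real (periodized_gaussian lam ((real m - real n) / real N))" for m
    have row: "(\<Sum>m<N. b m * exp (- 2 * of_real pi * \<i> * of_int (int l) * of_nat m / of_nat N)) = 0" for l :: nat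
    proof -
      have "gabor_theta N lam f (gabor_node N lam (real n) (int l)) = 0"
        by (intro zero) simp
      then have "(\<Sum>m<N. of_real (exp (pi * lam * (real n)\<^sup>2 / (real N)\<^sup>2)) *
          (b m * exp (- 2 * of_real pi * \<i> * of_int (int l) * of_nat m / of_nat N))) = 0"
        unfolding gabor_theta_def gauss_theta_at_node[OF N lam] b_def by (simp only: mult_ac)
      then show ?thesis
        unfolding sum_distrib_left[symmetric] by simp
    qed
    have "0 = (\<Sum>l<N. exp (2 * of_real pi * \<i> * of_int (int l * int n) / of_nat N) *
        (\<Sum>m<N. b m * exp (- 2 * of_real pi * \<i> * of_int (int l) * of_nat m / of_nat N)))"
      by (simp only: row) simp
    also have "\<dots> = (\<Sum>l<N. \<Sum>m<N. b m * exp (2 * of_real pi * \<i> * of_int (int l * (int n - int m)) / of_nat N))"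
    proof (intro sum.cong refl)
      fix l
      have "exp (2 * of_real pi * \<i> * of_int (int l * int n) / of_nat N) *
          exp (- 2 * of_real pi * \<i> * of_int (int l) * of_nat m / of_nat N) =
          exp (2 * of_real pi * \<i> * of_int (int l * (int n - int m)) / of_nat N :: complex)" for m
        unfolding exp_add[symmetric] using N by (simp add: field_simps)
      then show "exp (2 * of_real pi * \<i> * of_int (int l * int n) / of_nat N) *
          (\<Sum>m<N. b m * exp (- 2 * of_real pi * \<i> * of_int (int l) * of_nat m / of_nat N)) =
          (\<Sum>m<N. b m * exp (2 * of_real pi * \<i> * of_int (int l * (int n - int m)) / of_nat N))"
        unfolding sum_distrib_left by (intro sum.cong refl) (metis mult.left_commute)
    qed
    also have "\<dots> = (\<Sum>m<N. b m * (\<Sum>l<N. exp (2 * of_real pi * \<i> * of_int (int l * (int n - int m)) / of_nat N)))"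
      by (subst sum.swap) (simp only: sum_distrib_left)
    also have "\<dots> = (\<Sum>m<N. if m = n then b n * of_nat N else 0)"
    proof (intro sum.cong refl)
      fix m assume "m \<in> {..<N}"
      have "\<not> int N dvd int n - int m" if "m \<noteq> n"
      proof
        assume "int N dvd int n - int m"
        then have "\<bar>int N\<bar> \<le> \<bar>int n - int m\<bar>"
          using that by (intro dvd_imp_le_int) auto
        then show False using n \<open>m \<in> {..<N}\<close> by auto
      qed
      then show "b m * (\<Sum>l<N. exp (2 * of_real pi * \<i> * of_int (int l * (int n - int m)) / of_nat N)) =
          (if m = n then b n * of_nat N else 0)"
        using sum_roots_of_unity_int[OF N, of "int n - int m"] by auto
    qed
    also have "\<dots> = b n * of_nat N"
      using n by simp
    finally have "b n = 0" using N by simp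
    then show ?thesis
      using periodized_gaussian_pos[OF lam, of 0] by (simp add: b_def)
  qed
  then show ?thesis using f by (intro eq_vecI) auto
qed

end

section \<open>Zeros at the nodes\<close>

lemma mem_nat_multiples_iff: "N \<ge> 1 \<Longrightarrow> x \<ge> 0 \<Longrightarrow> x \<in> nat_multiples N \<longleftrightarrow> int N dvd x"
proof
  assume "N \<ge> 1" "x \<ge> 0" "int N dvd x"
  then obtain t where t: "x = int N * t" by blast
  with \<open>N \<ge> 1\<close> \<open>x \<ge> 0\<close> have "t \<ge> 0"
    by (simp add: zero_le_mult_iff)
  then have "x = int N * int (nat t)" using t by simp
  then show "x \<in> nat_multiples N" unfolding nat_multiples_def by blast
qed (auto simp: nat_multiples_def)

context
  fixes N K :: nat and lam :: real and j l :: "nat \<Rightarrow> int"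
  assumes N: "N \<ge> 1" and lam: "lam > 0"
    and j: "\<And>k. k \<in> {1..K} \<Longrightarrow> j k \<in> {0..int N - 1}"
    and l: "\<And>k. k \<in> {1..K} \<Longrightarrow> l k \<in> {0..int N - 1}"
    and inj: "inj_on (\<lambda>k. (j k, l k)) {1..K}"
begin

text \<open>
  Multiplication by \<open>p\<close> translates the time coordinate by \<open>- N\<close>, so congruent nodes agree in
  both coordinates modulo \<open>N\<close>.
\<close>

lemma nodes_incongruent:
  assumes k: "k \<in> {1..K}" "k' \<in> {1..K}"
    and eq: "gabor_node N lam (of_int (j k)) (l k) =
      gabor_node N lam (of_int (j k')) (l k') * of_real (theta_period N lam) powi n"
  shows "k = k'"
proof -
  have "gabor_node N lam (of_int (j k)) (l k) = gabor_node N lam (of_int (j k') - of_int n * real N) (l k')"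
    using eq by (simp add: theta_period_powi[OF N lam] gabor_node_mult)
  then have "real_of_int (j k) = of_int (j k') - of_int n * real N" and dvd: "int N dvd l k - l k'"
    unfolding gabor_node_eq_iff[OF N lam] by auto
  then have "real_of_int (j k - j k') = of_int (- n * int N)" by simp
  then have "int N dvd j k - j k'"
    unfolding of_int_eq_iff by simp
  moreover have small: "x = y" if "int N dvd x - y" "x \<in> {0..int N - 1}" "y \<in> {0..int N - 1}" for x y
  proof (rule ccontr)
    assume "x \<noteq> y"
    then have "\<bar>int N\<bar> \<le> \<bar>x - y\<bar>" using that(1) by (intro dvd_imp_le_int) auto
    then show False using that(2,3) by auto
  qed
  ultimately have "j k = j k'" "l k = l k'"
    using j[OF k(1)] j[OF k(2)] l[OF k(1)] l[OF k(2)] dvd by (auto intro!: small)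
  then show ?thesis
    using inj k by (auto dest: inj_onD)
qed

lemma gabor_theta_factorization:
  assumes "N \<le> K" and f: "f \<in> carrier_vec N"
    and zero: "\<And>k. k \<in> {1..N} \<Longrightarrow> discrete_gabor N (sample_periodization N (gaussian lam)) f (j k) (l k) = 0"
  obtains C and n :: int where
    "\<And>u. u \<noteq> 0 \<Longrightarrow> gabor_theta N lam f u =
        C * u powi n * (\<Prod>k=1..N. theta (theta_period N lam) (u / gabor_node N lam (of_int (j k)) (l k)))"
    and "C \<noteq> 0 \<Longrightarrow> even N \<and> int N dvd (\<Sum>k=1..N. j k) \<and> int N dvd (\<Sum>k=1..N. l k)"
proof -
  obtain C and n :: int where C: "\<And>u. u \<noteq> 0 \<Longrightarrow> gabor_theta N lam f u =
        C * u powi n * (\<Prod>k=1..N. theta (theta_period N lam) (u / gabor_node N lam (of_int (j k)) (l k)))"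
    and n: "C \<noteq> 0 \<Longrightarrow> of_real (exp (pi * lam)) = (- 1) ^ card {1..N} *
      (\<Prod>k=1..N. gabor_node N lam (of_int (j k)) (l k)) * of_real (theta_period N lam) powi n"
  proof (rule theta_factorization[OF theta_period_bounds[OF N lam], of "{1..N}" "gabor_theta N lam f" "of_real (exp (pi * lam))"
        "\<lambda>k. gabor_node N lam (of_int (j k)) (l k)"])
    show "gabor_theta N lam f (of_real (theta_period N lam) * u) * u ^ card {1..N} = of_real (exp (pi * lam)) * gabor_theta N lam f u"
      if "u \<noteq> 0" for u
      using gabor_theta_shift[OF N lam that] by simp
    show "gabor_theta N lam f (gabor_node N lam (of_int (j k)) (l k)) = 0" if "k \<in> {1..N}" for k
      using zero[OF that] discrete_gabor_eq_0_iff[OF N lam f] by simp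
    show "k = k'" if "k \<in> {1..N}" "k' \<in> {1..N}" "gabor_node N lam (of_int (j k)) (l k) =
      gabor_node N lam (of_int (j k')) (l k') * of_real (theta_period N lam) powi n" for k k' n
      using that \<open>N \<le> K\<close> by (intro nodes_incongruent[of k k' n]) auto
  qed (auto intro: gabor_theta_holomorphic[OF N lam] that)
  show thesis
  proof (rule that[OF C])
    assume "C \<noteq> 0"
    have "of_real (exp (pi * lam)) = (- 1) ^ N * gabor_node N lam (of_int (\<Sum>k=1..N. j k)) (\<Sum>k=1..N. l k) *
        of_real (theta_period N lam) powi n"
      using n[OF \<open>C \<noteq> 0\<close>] by (simp add: gabor_node_prod)
    then show "even N \<and> int N dvd (\<Sum>k=1..N. j k) \<and> int N dvd (\<Sum>k=1..N. l k)"
      using abel_condition[OF N lam] by blast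
  qed
qed

text \<open>
  The first \<open>N\<close> nodes determine the theta function up to a constant and a monomial, and the
  product of theta factors does not vanish at the next node.
\<close>

lemma injective_if_more_nodes:
  assumes "K \<ge> N + 1" and f: "f \<in> carrier_vec N"
    and zero: "\<And>k. k \<in> {1..K} \<Longrightarrow> discrete_gabor N (sample_periodization N (gaussian lam)) f (j k) (l k) = 0"
  shows "f = 0\<^sub>v N"
proof -
  obtain C and n :: int where C: "\<And>u. u \<noteq> 0 \<Longrightarrow> gabor_theta N lam f u =
        C * u powi n * (\<Prod>k=1..N. theta (theta_period N lam) (u / gabor_node N lam (of_int (j k)) (l k)))"
  proof (rule gabor_theta_factorization[OF _ f])
    show "N \<le> K" using assms(1) by simp
    show "discrete_gabor N (sample_periodization N (gaussian lam)) f (j k) (l k) = 0" if "k \<in> {1..N}" for k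
      using that assms(1) by (intro zero) auto
  qed (erule that)
  let ?a = "\<lambda>k. gabor_node N lam (of_int (j k)) (l k)"
  have "theta (theta_period N lam) (?a (N + 1) / ?a k) \<noteq> 0" if "k \<in> {1..N}" for k
  proof
    assume "theta (theta_period N lam) (?a (N + 1) / ?a k) = 0"
    then obtain i :: int where "?a (N + 1) / ?a k = of_real (theta_period N lam) powi i"
      using theta_eq_0_iff[OF theta_period_bounds[OF N lam], of "?a (N + 1) / ?a k"] by auto
    then have "?a (N + 1) = ?a k * of_real (theta_period N lam) powi i"
      by (simp add: field_simps)
    then have "N + 1 = k"
      using that assms(1) by (intro nodes_incongruent[of "N + 1" k i]) auto
    then show False using that by simp
  qed
  then have "(\<Prod>k=1..N. theta (theta_period N lam) (?a (N + 1) / ?a k)) \<noteq> 0"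
    by simp
  moreover have "gabor_theta N lam f (?a (N + 1)) = 0"
    using zero[of "N + 1"] discrete_gabor_eq_0_iff[OF N lam f] assms(1) by simp
  ultimately have "C = 0"
    using C[of "?a (N + 1)"] by simp
  then show ?thesis
    using C by (intro gabor_theta_zero_imp_zero[OF N lam f]) simp
qed

lemma injective_if_not_abel:
  assumes "K = N" and "\<not> (even N \<and> int N dvd (\<Sum>k=1..N. j k) \<and> int N dvd (\<Sum>k=1..N. l k))"
    and f: "f \<in> carrier_vec N"
    and zero: "\<And>k. k \<in> {1..K} \<Longrightarrow> discrete_gabor N (sample_periodization N (gaussian lam)) f (j k) (l k) = 0"
  shows "f = 0\<^sub>v N"
proof -
  obtain C and n :: int where C: "\<And>u. u \<noteq> 0 \<Longrightarrow> gabor_theta N lam f u =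
        C * u powi n * (\<Prod>k=1..N. theta (theta_period N lam) (u / gabor_node N lam (of_int (j k)) (l k)))"
    and "C \<noteq> 0 \<Longrightarrow> even N \<and> int N dvd (\<Sum>k=1..N. j k) \<and> int N dvd (\<Sum>k=1..N. l k)"
  proof (rule gabor_theta_factorization[OF _ f])
    show "N \<le> K" using assms(1) by simp
    show "discrete_gabor N (sample_periodization N (gaussian lam)) f (j k) (l k) = 0" if "k \<in> {1..N}" for k
      using that assms(1) by (intro zero) auto
  qed (erule that, blast)
  then have "C = 0" using assms(2) by blast
  then show ?thesis
    using C by (intro gabor_theta_zero_imp_zero[OF N lam f]) simp
qed

lemma kernel_of_few_nodes:
  assumes "M < N"
  obtains f where "f \<in> carrier_vec N" "f \<noteq> 0\<^sub>v N"
    and "\<And>k. k \<in> {1..M} \<Longrightarrow> discrete_gabor N g f (j k) (l k) = 0"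
proof -
  obtain f where f: "f \<in> carrier_vec N" "f \<noteq> 0\<^sub>v N"
    and zero: "\<And>k. k < M \<Longrightarrow> (\<Sum>m<N. (cnj (vec_at N g (int m - j (Suc k))) *
        exp (- 2 * of_real pi * \<i> * of_int (l (Suc k)) * of_nat m / of_nat N)) * vec_index f m) = 0"
    using underdetermined_system_solvable[OF assms, of "\<lambda>k m. cnj (vec_at N g (int m - j (Suc k))) *
        exp (- 2 * of_real pi * \<i> * of_int (l (Suc k)) * of_nat m / of_nat N)"] by blast
  have "discrete_gabor N g f (j k) (l k) = 0" if "k \<in> {1..M}" for k
  proof -
    have "discrete_gabor N g f (j k) (l k) = (\<Sum>m<N. (cnj (vec_at N g (int m - j (Suc (k - 1)))) *
        exp (- 2 * of_real pi * \<i> * of_int (l (Suc (k - 1))) * of_nat m / of_nat N)) * vec_index f m)"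
      using that f(1) by (subst discrete_gabor_eq_sum) (auto intro!: sum.cong)
    also have "\<dots> = 0"
      using that by (intro zero) auto
    finally show ?thesis .
  qed
  with f show thesis by (rule that)
qed

text \<open>
  By a dimension count some nonzero vector has a theta function \<open>F\<close> vanishing at all nodes but
  the last. By Abel's relation the theta product \<open>\<Phi>\<close> over all nodes transforms like \<open>F\<close>.
  The difference \<open>F - \<kappa> \<Phi>\<close> is given one further zero instead of the last node. This set of
  zeros violates Abel's relation, so \<open>F = \<kappa> \<Phi>\<close>.
\<close>

lemma not_injective_if_abel:
  assumes "K = N" and abel: "even N" "int N dvd (\<Sum>k=1..N. j k)" "int N dvd (\<Sum>k=1..N. l k)"
  obtains f where "f \<in> carrier_vec N" "f \<noteq> 0\<^sub>v N"
    and "\<And>k. k \<in> {1..K} \<Longrightarrow> discrete_gabor N (sample_periodization N (gaussian lam)) f (j k) (l k) = 0"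
proof -
  define p where "p = theta_period N lam"
  note p = theta_period_bounds[OF N lam, folded p_def]
  define a where "a k = gabor_node N lam (of_int (j k)) (l k)" for k
  \<comment> \<open>The last node is replaced by the point with the half-integral time coordinate \<open>1 / 2\<close>,
    which is congruent to no node.\<close>
  define a' where "a' k = (if k = N then gabor_node N lam (1 / 2) 0 else a k)" for k
  have a_nz: "a k \<noteq> 0" "a' k \<noteq> 0" for k
    by (simp_all add: a_def a'_def)
  have a'_a: "a' N \<noteq> a k * of_real p powi i" for k and i :: int
  proof
    assume "a' N = a k * of_real p powi i"
    then have "gabor_node N lam (1 / 2) 0 = gabor_node N lam (of_int (j k) - of_int i * real N) (l k)"
      by (simp add: a_def a'_def p_def theta_period_powi[OF N lam] gabor_node_mult)
    then have "1 / 2 = of_int (j k) - of_int i * real N"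
      by (simp only: gabor_node_eq_iff[OF N lam])
    then have "real_of_int 1 = of_int (2 * (j k - i * int N))" by simp
    then have "1 = 2 * (j k - i * int N)" by (simp only: of_int_eq_iff)
    then show False by presburger
  qed
  obtain f where f: "f \<in> carrier_vec N" "f \<noteq> 0\<^sub>v N"
    and "\<And>k. k \<in> {1..N - 1} \<Longrightarrow> discrete_gabor N (sample_periodization N (gaussian lam)) f (j k) (l k) = 0"
    using N kernel_of_few_nodes[of "N - 1"] by auto
  then have zero: "gabor_theta N lam f (a k) = 0" if "k \<in> {1..N - 1}" for k
    using that discrete_gabor_eq_0_iff[OF N lam f(1)] by (simp add: a_def)
  obtain n :: int where n: "of_real (exp (pi * lam)) = (- 1) ^ N * (\<Prod>k=1..N. a k) * of_real p powi n"
    using abel_condition[OF N lam, of "\<Sum>k=1..N. j k" "\<Sum>k=1..N. l k"] abel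
    by (auto simp: p_def a_def gabor_node_prod)
  define \<Phi> where "\<Phi> u = u powi n * (\<Prod>k=1..N. theta p (u / a k))" for u
  have \<Phi>_hol: "\<Phi> holomorphic_on - {0}"
    unfolding \<Phi>_def by (intro holomorphic_intros theta_quotient_holomorphic p a_nz) auto
  have \<Phi>_shift: "\<Phi> (of_real p * u) * u ^ N = of_real (exp (pi * lam)) * \<Phi> u" if u: "u \<noteq> 0" for u
  proof -
    have "(\<Prod>k=1..N. theta p (of_real p * u / a k)) = (\<Prod>k=1..N. - 1 * a k / u * theta p (u / a k))"
    proof (intro prod.cong refl)
      fix k
      show "theta p (of_real p * u / a k) = - 1 * a k / u * theta p (u / a k)"
        using theta_shift[OF p, of "u / a k"] u a_nz[of k] by simp
    qed
    also have "\<dots> = (- 1) ^ N * (\<Prod>k=1..N. a k) / u ^ N * (\<Prod>k=1..N. theta p (u / a k))"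
      by (simp only: prod.distrib prod_dividef) simp
    finally show ?thesis
      using u by (simp add: \<Phi>_def n power_int_mult_distrib)
  qed
  have \<Phi>_zero: "\<Phi> (a k) = 0" if "k \<in> {1..N}" for k
  proof -
    have "theta p (a k / a k) = 0"
      using a_nz[of k] by (simp add: theta_eq_0_iff[OF p]) (metis power_int_0_right)
    then have "(\<Prod>i=1..N. theta p (a k / a i)) = 0"
      using that by (intro prod_zero bexI[of _ k]) simp_all
    then show ?thesis by (simp add: \<Phi>_def)
  qed
  have "theta p (a' N / a k) \<noteq> 0" for k
    using a'_a[of k] a_nz by (auto simp: theta_eq_0_iff[OF p] field_simps)
  then have \<Phi>_nz: "\<Phi> (a' N) \<noteq> 0"
    using a_nz by (simp add: \<Phi>_def)
  define \<kappa> where "\<kappa> = gabor_theta N lam f (a' N) / \<Phi> (a' N)"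
  obtain C and n' :: int where C: "\<And>u. u \<noteq> 0 \<Longrightarrow> gabor_theta N lam f u - \<kappa> * \<Phi> u =
        C * u powi n' * (\<Prod>k=1..N. theta p (u / a' k))"
    and n': "C \<noteq> 0 \<Longrightarrow> of_real (exp (pi * lam)) = (- 1) ^ card {1..N} * (\<Prod>k=1..N. a' k) * of_real p powi n'"
  proof (rule theta_factorization[OF p, of "{1..N}" "\<lambda>u. gabor_theta N lam f u - \<kappa> * \<Phi> u"
        "of_real (exp (pi * lam))" a'])
    show "(\<lambda>u. gabor_theta N lam f u - \<kappa> * \<Phi> u) holomorphic_on - {0}"
      by (intro holomorphic_intros gabor_theta_holomorphic N lam \<Phi>_hol)
    show "(gabor_theta N lam f (of_real p * u) - \<kappa> * \<Phi> (of_real p * u)) * u ^ card {1..N} =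
        of_real (exp (pi * lam)) * (gabor_theta N lam f u - \<kappa> * \<Phi> u)" if "u \<noteq> 0" for u
    proof -
      have "(gabor_theta N lam f (of_real p * u) - \<kappa> * \<Phi> (of_real p * u)) * u ^ card {1..N} =
          gabor_theta N lam f (of_real p * u) * u ^ N - \<kappa> * (\<Phi> (of_real p * u) * u ^ N)"
        by (simp add: algebra_simps)
      also have "\<dots> = of_real (exp (pi * lam)) * gabor_theta N lam f u - \<kappa> * (of_real (exp (pi * lam)) * \<Phi> u)"
        by (simp only: \<Phi>_shift[OF that] gabor_theta_shift[OF N lam that, folded p_def])
      finally show ?thesis by (simp add: algebra_simps)
    qed
    show "gabor_theta N lam f (a' k) - \<kappa> * \<Phi> (a' k) = 0" if "k \<in> {1..N}" for k
    proof (cases "k = N")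
      case True
      then show ?thesis using \<Phi>_nz by (simp add: \<kappa>_def)
    next
      case False
      then show ?thesis using that zero[of k] \<Phi>_zero[of k] by (auto simp: a'_def)
    qed
    show "k = k'" if "k \<in> {1..N}" "k' \<in> {1..N}" "a' k = a' k' * of_real p powi i" for k k' and i :: int
    proof (cases "k = N"; cases "k' = N")
      assume "k = N" "k' \<noteq> N"
      then show ?thesis using a'_a[of k' i] that(3) by (simp add: a'_def)
    next
      assume "k \<noteq> N" "k' = N"
      then have "a' N = a k * of_real p powi (- i)"
        using that(3) p by (simp add: a'_def[of k] power_int_minus)
      then show ?thesis using a'_a by blast
    next
      assume "k \<noteq> N" "k' \<noteq> N"
      then show ?thesis
        using that \<open>K = N\<close> by (intro nodes_incongruent[of k k' i]) (auto simp: a'_def a_def p_def)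
    qed simp
  qed (use a_nz in \<open>auto intro: that\<close>)
  \<comment> \<open>Otherwise both sets of zeros satisfy Abel's relation, and the exchanged points are congruent.\<close>
  have "C = 0"
  proof (rule ccontr)
    assume "C \<noteq> 0"
    have split_last: "(\<Prod>k=1..N. b k) = b N * (\<Prod>k=1..N - 1. b k)" for b :: "nat \<Rightarrow> complex"
      using N by (cases N) (auto simp: mult.commute)
    have eq: "(\<Prod>k=1..N - 1. a' k) = (\<Prod>k=1..N - 1. a k)"
      using N by (intro prod.cong) (auto simp: a'_def)
    have "(\<Prod>k=1..N. a' k) * of_real p powi n' = (\<Prod>k=1..N. a k) * of_real p powi n"
      using n n'[OF \<open>C \<noteq> 0\<close>] by simp
    then have "(\<Prod>k=1..N - 1. a k) * (a' N * of_real p powi n') = (\<Prod>k=1..N - 1. a k) * (a N * of_real p powi n)"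
      unfolding split_last[of a'] split_last[of a] eq by (simp only: mult_ac)
    then have "a' N * of_real p powi n' = a N * of_real p powi n"
      using a_nz by (subst (asm) mult_left_cancel) auto
    then have "a' N = a N * of_real p powi (n - n')"
      using p by (simp add: power_int_diff field_simps)
    then show False using a'_a by blast
  qed
  then have "gabor_theta N lam f (a N) = 0"
    using C[of "a N"] \<Phi>_zero[of N] a_nz N by simp
  then have "gabor_theta N lam f (a k) = 0" if "k \<in> {1..K}" for k
    using that zero[of k] \<open>K = N\<close> by (cases "k = N") auto
  then have "discrete_gabor N (sample_periodization N (gaussian lam)) f (j k) (l k) = 0" if "k \<in> {1..K}" for k
    using that discrete_gabor_eq_0_iff[OF N lam f(1)] by (simp add: a_def)
  with f show thesis by (rule that)
qed

lemma card_nodes_le: "K \<le> N\<^sup>2"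
proof -
  have "card {1..K} \<le> card ({0..int N - 1} \<times> {0..int N - 1})"
    using inj j l by (intro card_inj_on_le[of "\<lambda>k. (j k, l k)"]) auto
  then show ?thesis
    by (simp add: power2_eq_square card_cartesian_product)
qed

end

theorem theorem3:
  fixes N K :: nat and lam :: real and j l :: "nat \<Rightarrow> int"
  assumes "N \<ge> 1" and "lam > 0"
    and "\<And>k. k \<in> {1..K} \<Longrightarrow> j k \<in> {0..int N - 1}"
    and "\<And>k. k \<in> {1..K} \<Longrightarrow> l k \<in> {0..int N - 1}"
    and "inj_on (\<lambda>k. (j k, l k)) {1..K}"
  shows "gabor_frame N (sample_periodization N (gaussian lam)) K j l \<longleftrightarrow>
     (N\<^sup>2 \<ge> K \<and> K \<ge> N + 1) \<or>
     (K = N \<and> odd N) \<or>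
     (K = N \<and> even N \<and>
        (\<Sum>k=1..N. (j k, l k)) \<notin> nat_multiples N \<times> nat_multiples N)"
proof -
  let ?h = "sample_periodization N (gaussian lam)"
  let ?inj = "\<forall>f\<in>carrier_vec N. (\<forall>k\<in>{1..K}. discrete_gabor N ?h f (j k) (l k) = 0) \<longrightarrow> f = 0\<^sub>v N"
  let ?abel = "int N dvd (\<Sum>k=1..N. j k) \<and> int N dvd (\<Sum>k=1..N. l k)"
  have abel: "(\<Sum>k=1..N. (j k, l k)) \<in> nat_multiples N \<times> nat_multiples N \<longleftrightarrow> ?abel" if "K = N"
  proof -
    have "(\<Sum>k=1..N. j k) \<ge> 0" "(\<Sum>k=1..N. l k) \<ge> 0"
      using assms(3,4) that by (auto intro!: sum_nonneg)
    then show ?thesis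
      using \<open>N \<ge> 1\<close> by (simp add: mem_Times_iff fst_sum snd_sum mem_nat_multiples_iff)
  qed
  have "K \<le> N\<^sup>2"
    using card_nodes_le[OF assms] .
  consider "K < N" | "K = N" | "K \<ge> N + 1" by linarith
  then have "?inj \<longleftrightarrow> (N\<^sup>2 \<ge> K \<and> K \<ge> N + 1) \<or> (K = N \<and> odd N) \<or> (K = N \<and> even N \<and> \<not> ?abel)"
  proof cases
    case 1
    then obtain f where "f \<in> carrier_vec N" "f \<noteq> 0\<^sub>v N"
      "\<And>k. k \<in> {1..K} \<Longrightarrow> discrete_gabor N ?h f (j k) (l k) = 0"
      using kernel_of_few_nodes[OF assms] by blast
    then have "\<not> ?inj" by blast
    then show ?thesis using 1 by simp
  next
    case 2
    show ?thesis
    proof (cases "even N \<and> ?abel")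
      case True
      then obtain f where "f \<in> carrier_vec N" "f \<noteq> 0\<^sub>v N"
        "\<And>k. k \<in> {1..K} \<Longrightarrow> discrete_gabor N ?h f (j k) (l k) = 0"
        using not_injective_if_abel[OF assms 2] by blast
      then have "\<not> ?inj" by blast
      then show ?thesis using 2 True by simp
    next
      case False
      then have ?inj
        using injective_if_not_abel[OF assms 2] by blast
      then show ?thesis using 2 False by blast
    qed
  next
    case 3
    then have ?inj
      using injective_if_more_nodes[OF assms] by blast
    then show ?thesis using 3 \<open>K \<le> N\<^sup>2\<close> by blast
  qed
  moreover have "K = N \<longrightarrow> ((\<Sum>k=1..N. (j k, l k)) \<in> nat_multiples N \<times> nat_multiples N \<longleftrightarrow> ?abel)"
    using abel by (rule impI)
  ultimately show ?thesis
    unfolding gabor_frame_iff_injective[OF \<open>N \<ge> 1\<close>] by argo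
qed

end
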